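(* Suppose the following conditions hold. (A) $r_0(t;w)\ge0$ for all $t\ge t_0$, $w\in(-\infty;+\infty)$. (B) There exists $\varepsilon_0>0$ such that for every $\varepsilon\in(0;\varepsilon_0]$ $$p_0(t;w)\le p_\varepsilon(t),\qquad \frac{q_0(t;w)}{p_0(t;w)}\ge\frac{q_\varepsilon(t)}{p_\varepsilon(t)},\qquad r_0(t;w)\ge r_\varepsilon(t)\qquad\text{for } |w|\ge\varepsilon,\ t\ge t_0,$$ and the linear equation $(p_\varepsilon(t)\phi'(t))'+q_\varepsilon(t)\phi'(t)+r_\varepsilon(t)\phi(t)=0$, $t\ge t_0$, is oscillatory. (C) There exists $N>0$ such that: (C1) $p_0(t;w)\le P(t)$ and $\frac{q_0(t;w)}{p_0(t;w)}\le Q(t)$ for $|w|\le N$, $t\ge t_0$, and $$\int_{t_0}^{+\infty}\exp\Bigl\{-\int_{t_0}^\tau Q(s)\,ds\Bigr\}\frac{d\tau}{P(\tau)}=+\infty;$$ (C2) for every $\varepsilon\ge N$: $p_0(t;w)\le p_\varepsilon(t)$, $\frac{q_0(t;w)}{p_0(t;w)}\le q_\varepsilon(t)$, $r_0(t;w)\ge r_\varepsilon(t)$ for $N\le|w|\le\varepsilon$, $t\ge t_0$, and $$\int_{t_0}^{+\infty}\frac{d\tau}{p_\varepsilon(\tau)}\int_{t_0}^\tau\exp\Bigl\{-\int_s^\tau q_\varepsilon(\xi)\,d\xi\Bigr\}r_\varepsilon(s)\,ds=+\infty.$$ Then each nontrivial solution of the equation $$(p_0(t;\phi(t))\phi'(t))'+q_0(t;\phi(t))\phi'(t)+r_0(t;\phi(t))\phi(t)=0,\qquad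 t\ge t_0,$$ existing on $[t_0;+\infty)$ is either oscillatory or singular oscillatory of first kind.
   Context: Fix $t_0\in\mathbb{R}$. The functions $p_0(t;w),q_0(t;w),r_0(t;w)$ are real valued and continuous on $[t_0;+\infty)\times(-\infty;+\infty)$, with $p_0(t;w)>0$ everywhere. The functions $P(t),Q(t)$ are real valued and continuous on $[t_0;+\infty)$, with $P(t)>0$. For every $\varepsilon>0$ the functions $p_\varepsilon(t),q_\varepsilon(t),r_\varepsilon(t)$ are real valued and continuous on $[t_0;+\infty)$, with $p_\varepsilon(t)>0$. A solution of the nonlinear equation is a continuously differentiable function $\phi$ such that $p_0(t;\phi(t))\phi'(t)$ is continuously differentiable and the equation holds. A solution is called oscillatory if it exists on $[t_0;+\infty)$ and changes sign in every neighborhood of $+\infty$. A solution $\phi(t)$ is called singular oscillatory of first kind if it exists on $[t_0;+\infty)$, its support $\operatorname{supp}\phi$ is bounded, and $\phi$ changes sign infinitely many times. A linear equation is called oscillatory if all its nontrivial solutions are oscillatory. *)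

theory Defs
  imports "HOL-Analysis.Analysis"
begin

text \<open>
  Everything lives on the half line \<open>[t0, \<infinity>)\<close>. Functions are total in HOL, but only their values
  on \<open>{t0..}\<close> matter; derivatives are taken within \<open>{t0..}\<close>, hence are one-sided at \<open>t0\<close>.
\<close>

definition C1_on_with :: "real set \<Rightarrow> (real \<Rightarrow> real) \<Rightarrow> (real \<Rightarrow> real) \<Rightarrow> bool" where
  "C1_on_with S f f' \<longleftrightarrow>
     (\<forall>t\<in>S. (f has_real_derivative f' t) (at t within S)) \<and> continuous_on S f'"

text \<open>
  Solutions on all of \<open>[t0, \<infinity>)\<close> of
  \<open>(p(t,\<phi>(t)) \<phi>'(t))' + q(t,\<phi>(t)) \<phi>'(t) + r(t,\<phi>(t)) \<phi>(t) = 0\<close>.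
  The witness \<open>d\<close> is \<open>\<phi>'\<close> and \<open>e\<close> is \<open>(p(t,\<phi>(t)) \<phi>'(t))'\<close>; both are uniquely
  determined on \<open>{t0..}\<close>.
\<close>

definition is_solution ::
  "real \<Rightarrow> (real \<Rightarrow> real \<Rightarrow> real) \<Rightarrow> (real \<Rightarrow> real \<Rightarrow> real) \<Rightarrow> (real \<Rightarrow> real \<Rightarrow> real) \<Rightarrow> (real \<Rightarrow> real) \<Rightarrow> bool"
where
  "is_solution t0 p q r \<phi> \<longleftrightarrow>
     (\<exists>d e. C1_on_with {t0..} \<phi> d \<and>
            C1_on_with {t0..} (\<lambda>t. p t (\<phi> t) * d t) e \<and>
            (\<forall>t\<ge>t0. e t + q t (\<phi> t) * d t + r t (\<phi> t) * \<phi> t = 0))"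

definition nontrivial_on :: "real set \<Rightarrow> (real \<Rightarrow> real) \<Rightarrow> bool" where
  "nontrivial_on S \<phi> \<longleftrightarrow> (\<exists>t\<in>S. \<phi> t \<noteq> 0)"

definition changes_sign_on :: "real set \<Rightarrow> (real \<Rightarrow> real) \<Rightarrow> bool" where
  "changes_sign_on S \<phi> \<longleftrightarrow> (\<exists>s\<in>S. \<exists>t\<in>S. \<phi> s < 0 \<and> 0 < \<phi> t)"

text \<open>
  At least \<open>n\<close> sign changes for every \<open>n\<close>. An infinite increasing sequence of sign changes is
  not demanded, so sign changes may accumulate from either side.
\<close>

definition changes_sign_infinitely_often_on :: "real set \<Rightarrow> (real \<Rightarrow> real) \<Rightarrow> bool" where
  "changes_sign_infinitely_often_on S \<phi> \<longleftrightarrow>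
     (\<forall>n::nat. \<exists>\<tau>::nat \<Rightarrow> real. (\<forall>i\<le>n. \<tau> i \<in> S) \<and>
        (\<forall>i<n. \<tau> i < \<tau> (Suc i) \<and> \<phi> (\<tau> i) * \<phi> (\<tau> (Suc i)) < 0))"

definition oscillatory_solution ::
  "real \<Rightarrow> (real \<Rightarrow> real \<Rightarrow> real) \<Rightarrow> (real \<Rightarrow> real \<Rightarrow> real) \<Rightarrow> (real \<Rightarrow> real \<Rightarrow> real) \<Rightarrow> (real \<Rightarrow> real) \<Rightarrow> bool"
where
  "oscillatory_solution t0 p q r \<phi> \<longleftrightarrow>
     is_solution t0 p q r \<phi> \<and> (\<forall>T\<ge>t0. changes_sign_on {T<..} \<phi>)"

definition singular_oscillatory_first_kind ::
  "real \<Rightarrow> (real \<Rightarrow> real \<Rightarrow> real) \<Rightarrow> (real \<Rightarrow> real \<Rightarrow> real) \<Rightarrow> (real \<Rightarrow> real \<Rightarrow> real) \<Rightarrow> (real \<Rightarrow> real) \<Rightarrow> bool"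
where
  "singular_oscillatory_first_kind t0 p q r \<phi> \<longleftrightarrow>
     is_solution t0 p q r \<phi> \<and>
     bounded (closure {t\<in>{t0..}. \<phi> t \<noteq> 0}) \<and>
     changes_sign_infinitely_often_on {t0..} \<phi>"

text \<open>
  The linear equation \<open>(p \<phi>')' + q \<phi>' + r \<phi> = 0\<close> is the case of coefficients that do not
  depend on the second argument; its solutions all extend to \<open>[t0, \<infinity>)\<close>.
\<close>

definition linear_equation_oscillatory ::
  "real \<Rightarrow> (real \<Rightarrow> real) \<Rightarrow> (real \<Rightarrow> real) \<Rightarrow> (real \<Rightarrow> real) \<Rightarrow> bool"
where
  "linear_equation_oscillatory t0 p q r \<longleftrightarrow>
     (\<forall>\<phi>. is_solution t0 (\<lambda>t w. p t) (\<lambda>t w. q t) (\<lambda>t w. r t) \<phi> \<and> nontrivial_on {t0..} \<phi> \<longrightarrow>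
          oscillatory_solution t0 (\<lambda>t w. p t) (\<lambda>t w. q t) (\<lambda>t w. r t) \<phi>)"

text \<open>
  The improper integral of \<open>f\<close> over \<open>[t0, \<infinity>)\<close> equals \<open>+\<infinity>\<close>, as a limit of integrals over
  \<open>[t0, T]\<close>; \<open>f\<close> may change sign. A non-integrable \<open>f\<close> would have integral 0 in HOL, so
  integrability on compact intervals is included.
\<close>

definition improper_integral_infinite :: "real \<Rightarrow> (real \<Rightarrow> real) \<Rightarrow> bool" where
  "improper_integral_infinite t0 f \<longleftrightarrow>
     (\<forall>T\<ge>t0. f integrable_on {t0..T}) \<and>
     filterlim (\<lambda>T. integral {t0..T} f) at_top at_top"

end

theory Submission
  imports Defs
begin

text \<open>
  Freezing the coefficients along the solution turns the equation into a linear system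
  \<open>\<phi>' = y / a\<close>, \<open>y' = - g y - c \<phi>\<close> with \<open>c \<ge> 0\<close>. While \<open>\<phi> \<ge> 0\<close>, the function
  \<open>y exp (\<integral> g)\<close> is nonincreasing. If \<open>\<phi>\<close> vanishes eventually, then \<open>y = 0\<close> at the end of its
  support, so \<open>\<phi>\<close> would be monotone the wrong way if it had a sign just before that point.
  Otherwise a nonoscillatory \<open>\<phi>\<close> may be taken positive eventually. If \<open>y \<ge> 0\<close> forever, \<open>\<phi>\<close> is
  bounded away from 0, and \<open>y / \<phi>\<close> satisfies the Riccati inequality of the linear equation
  in (B), which is then not oscillatory. If \<open>y\<close> becomes negative, it stays so and \<open>\<phi>\<close> decreases;
  the divergent integrals in (C1) (once \<open>\<phi> \<le> N\<close>) or (C2) (if \<open>\<phi> > N\<close> forever) drive \<open>\<phi>\<close>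
  below 0.
\<close>

section \<open>Calculus on a half line: one-sided derivatives, Gronwall decay, divergent
  integrals\<close>

lemma at_within_atLeast_real:
  fixes t :: real
  assumes "t0 < t"
  shows "at t within {t0..} = at t"
  by (rule at_within_open_subset[of t "{t0<..}"]) (use assms in auto)

lemma at_within_atLeast_eq_Icc:
  fixes t :: real
  assumes "t < T"
  shows "at t within {t0..} = at t within {t0..T}"
  by (rule at_within_nhd[of _ "{..<T}"]) (use assms in auto)

lemma deriv_nonpos_imp_le:
  fixes f :: "real \<Rightarrow> real"
  assumes "s \<le> t"
    and deriv: "\<And>\<tau>. \<tau> \<in> {s..t} \<Longrightarrow> (f has_real_derivative f' \<tau>) (at \<tau> within {s..t})"
    and nonpos: "\<And>\<tau>. s < \<tau> \<Longrightarrow> \<tau> < t \<Longrightarrow> f' \<tau> \<le> 0"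
  shows "f t \<le> f s"
proof (rule DERIV_nonpos_imp_decreasing_open[OF \<open>s \<le> t\<close>])
  fix \<tau> assume \<tau>: "s < \<tau>" "\<tau> < t"
  then show "\<exists>y. (f has_real_derivative y) (at \<tau>) \<and> y \<le> 0"
    using deriv[of \<tau>] nonpos[of \<tau>] by (auto simp: at_within_Icc_at)
next
  show "continuous_on {s..t} f"
    using deriv by (intro DERIV_continuous_on) auto
qed

lemma deriv_nonneg_imp_le:
  fixes f :: "real \<Rightarrow> real"
  assumes "s \<le> t"
    and "\<And>\<tau>. \<tau> \<in> {s..t} \<Longrightarrow> (f has_real_derivative f' \<tau>) (at \<tau> within {s..t})"
    and "\<And>\<tau>. s < \<tau> \<Longrightarrow> \<tau> < t \<Longrightarrow> f' \<tau> \<ge> 0"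
  shows "f s \<le> f t"
  using deriv_nonpos_imp_le[of s t "\<lambda>t. - f t" "\<lambda>t. - f' t"] assms
  by (auto intro: derivative_intros)

lemma integral_has_vector_derivative_atLeast:
  fixes g :: "real \<Rightarrow> 'a::banach"
  assumes "continuous_on {t0..} g" "t0 \<le> t"
  shows "((\<lambda>x. integral {t0..x} g) has_vector_derivative g t) (at t within {t0..})"
proof -
  have "((\<lambda>x. integral {t0..x} g) has_vector_derivative g t) (at t within {t0..t+1})"
    by (rule integral_has_vector_derivative)
       (use assms in \<open>auto intro: continuous_on_subset\<close>)
  then show ?thesis by (simp add: at_within_atLeast_eq_Icc[of t "t+1"])
qed

lemma integral_has_real_derivative_atLeast:
  assumes "continuous_on {t0..} g" "t0 \<le> t"
  shows "((\<lambda>x. integral {t0..x} g) has_real_derivative g t) (at t within {t0..})"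
  using integral_has_vector_derivative_atLeast[OF assms]
  by (simp add: has_real_derivative_iff_has_vector_derivative)

lemma integral_split_real:
  fixes g :: "real \<Rightarrow> real"
  assumes "continuous_on {t0..} g" "t0 \<le> s" "s \<le> t"
  shows "integral {t0..s} g + integral {s..t} g = integral {t0..t} g"
  using assms
  by (intro Henstock_Kurzweil_Integration.integral_combine integrable_continuous_real)
     (auto intro: continuous_on_subset)

text \<open>With the integrating factor \<open>exp (\<integral> g)\<close>, the product
  \<open>Y exp (\<integral> g)\<close> is nonincreasing. The inequality is asked only in the open
  interval because Picone's identity will supply it only there.\<close>

lemma gronwall_decay:
  fixes Y g :: "real \<Rightarrow> real"
  assumes "s \<le> t" and g: "continuous_on {s..t} g"
    and Y: "\<And>\<tau>. \<tau> \<in> {s..t} \<Longrightarrow> (Y has_real_derivative Y' \<tau>) (at \<tau> within {s..t})"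
    and le: "\<And>\<tau>. s < \<tau> \<Longrightarrow> \<tau> < t \<Longrightarrow> Y' \<tau> \<le> - (g \<tau> * Y \<tau>)"
  shows "Y t \<le> Y s * exp (- integral {s..t} g)"
proof -
  define m where "m \<tau> = exp (integral {s..\<tau>} g)" for \<tau>
  have m: "(m has_real_derivative g \<tau> * m \<tau>) (at \<tau> within {s..t})" if "\<tau> \<in> {s..t}" for \<tau>
    unfolding m_def using integral_has_real_derivative[OF g that]
    by (auto intro!: derivative_eq_intros)
  have "Y t * m t \<le> Y s * m s"
  proof (rule deriv_nonpos_imp_le[OF \<open>s \<le> t\<close>])
    fix \<tau> assume \<tau>: "\<tau> \<in> {s..t}"
    show "((\<lambda>\<tau>. Y \<tau> * m \<tau>) has_real_derivative (Y' \<tau> + g \<tau> * Y \<tau>) * m \<tau>) (at \<tau> within {s..t})"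
      using Y[OF \<tau>] m[OF \<tau>] by (auto intro!: derivative_eq_intros simp: algebra_simps)
  next
    fix \<tau> assume "s < \<tau>" "\<tau> < t"
    then show "(Y' \<tau> + g \<tau> * Y \<tau>) * m \<tau> \<le> 0"
      using le[of \<tau>] by (auto simp: m_def mult_le_0_iff)
  qed
  moreover have "m s = 1" "m t > 0" by (auto simp: m_def)
  ultimately show ?thesis by (simp add: exp_minus m_def field_simps)
qed

text \<open>Integrating the bound on \<open>h\<close> from \<open>s\<close> compares
  \<open>\<psi>\<close> with a tail of the divergent integral, which differs from the full integral
  by a constant. A single large \<open>T\<close> suffices, so \<open>f\<close> may change
  sign.\<close>

lemma unbounded_below_if_deriv_le:
  fixes \<psi> f :: "real \<Rightarrow> real"
  assumes "t0 \<le> s" "K > 0" and inf: "improper_integral_infinite t0 f"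
    and \<psi>: "\<And>t. t \<ge> s \<Longrightarrow> (\<psi> has_real_derivative h t) (at t within {s..})"
    and le: "\<And>t. t \<ge> s \<Longrightarrow> h t \<le> - (K * f t)"
  shows "\<exists>t\<ge>s. \<psi> t < B"
proof -
  \<comment> \<open>Once the integral of \<open>f\<close> over \<open>{t0..T}\<close> exceeds
    \<open>C\<close>, the guaranteed decrease of \<open>\<psi>\<close> from \<open>s\<close> to
    \<open>T\<close> exceeds \<open>\<psi> s - B\<close>.\<close>
  define C where "C = (\<psi> s - B) / K + integral {t0..s} f"
  have "eventually (\<lambda>T. integral {t0..T} f > C) at_top"
    using inf by (simp add: improper_integral_infinite_def filterlim_at_top_dense)
  then have "eventually (\<lambda>T. integral {t0..T} f > C \<and> T \<ge> s) at_top"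
    using eventually_ge_at_top[of s] by eventually_elim auto
  then obtain T where T: "integral {t0..T} f > C" "T \<ge> s"
    by (auto simp: eventually_at_top_linorder)
  have "(h has_integral \<psi> T - \<psi> s) {s..T}"
  proof (rule fundamental_theorem_of_calculus[OF T(2)])
    fix t assume "t \<in> {s..T}"
    then have "(\<psi> has_real_derivative h t) (at t within {s..T})"
      by (intro DERIV_subset[OF \<psi>]) auto
    then show "(\<psi> has_vector_derivative h t) (at t within {s..T})"
      by (simp add: has_real_derivative_iff_has_vector_derivative)
  qed
  moreover have int: "f integrable_on {t0..T}"
    using inf T assms(1) by (auto simp: improper_integral_infinite_def)
  then have "f integrable_on {s..T}"
    by (rule integrable_subinterval_real) (use assms(1) in auto)
  then have "((\<lambda>t. - (K * f t)) has_integral - (K * integral {s..T} f)) {s..T}"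
    by (intro has_integral_neg has_integral_mult_right) auto
  ultimately have "\<psi> T - \<psi> s \<le> - (K * integral {s..T} f)"
    using le by (elim has_integral_le) auto
  also have "integral {s..T} f = integral {t0..T} f - integral {t0..s} f"
    using Henstock_Kurzweil_Integration.integral_combine[OF assms(1) T(2) int] by simp
  finally have "\<psi> T - \<psi> s \<le> - (K * (integral {t0..T} f - integral {t0..s} f))" .
  moreover have "K * (integral {t0..T} f - integral {t0..s} f) > \<psi> s - B"
    using T(1) \<open>K > 0\<close> by (simp add: C_def field_simps)
  ultimately show ?thesis using T(2) by (intro exI[of _ T]) auto
qed

section \<open>Global existence by Picard iteration\<close>

text \<open>Oscillation of a linear equation speaks about all its nontrivial solutions, so refuting
  it requires that one exists. On \<open>{t0..T}\<close> successive Picard iterates differ by at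
  most \<open>C (L (t - t0))^n / n!\<close>. This is summable for every \<open>T\<close>, so no
  continuation argument is needed.\<close>

lemma picard_global_existence:
  fixes f :: "real \<Rightarrow> 'a::banach \<Rightarrow> 'a"
  assumes cont: "continuous_on ({t0..} \<times> UNIV) (\<lambda>(t, x). f t x)"
    and lip: "\<And>T. T \<ge> t0 \<Longrightarrow> \<exists>L. \<forall>t\<in>{t0..T}. \<forall>x y. norm (f t x - f t y) \<le> L * norm (x - y)"
  shows "\<exists>x. x t0 = x0 \<and> (\<forall>t\<ge>t0. (x has_vector_derivative f t (x t)) (at t within {t0..}))"
proof -
  have contf: "continuous_on S (\<lambda>s. f s (y s))" if "continuous_on S y" "S \<subseteq> {t0..}" for y S
  proof -
    have "continuous_on S (\<lambda>s. (s, y s))" by (intro continuous_intros that)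
    from continuous_on_compose2[OF cont this] show ?thesis using that(2) by auto
  qed
  define X where "X = rec_nat (\<lambda>t. x0) (\<lambda>_ y t. x0 + integral {t0..t} (\<lambda>s. f s (y s)))"
  have X0: "X 0 t = x0" and XS: "X (Suc n) t = x0 + integral {t0..t} (\<lambda>s. f s (X n s))" for n t
    by (simp_all add: X_def)
  have contX: "continuous_on {t0..T} (X n)" for n T
  proof (induction n)
    case (Suc n)
    have "continuous_on {t0..T} (\<lambda>t. x0 + integral {t0..t} (\<lambda>s. f s (X n s)))"
      by (intro continuous_intros indefinite_integral_continuous_1 integrable_continuous_real
          contf Suc) auto
    then show ?case by (simp add: XS cong: continuous_on_cong)
  qed (simp add: X0 cong: continuous_on_cong)
  \<comment> \<open>The limit is written through the pointwise \<open>lim\<close>, which does not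
    depend on \<open>T\<close>: the limits on different intervals are one function and need no
    gluing.\<close>
  have lim: "uniform_limit {t0..T} X (\<lambda>t. lim (\<lambda>n. X n t)) sequentially" for T
  proof (cases "T \<ge> t0")
    case True
    obtain L' where L': "\<forall>t\<in>{t0..T}. \<forall>x y. norm (f t x - f t y) \<le> L' * norm (x - y)"
      using lip[OF True] by blast
    define L where "L = \<bar>L'\<bar>"
    have L: "norm (f t x - f t y) \<le> L * norm (x - y)" if "t \<in> {t0..T}" for t x y
    proof -
      have "norm (f t x - f t y) \<le> L' * norm (x - y)" using L' that by blast
      also have "\<dots> \<le> L * norm (x - y)" by (intro mult_right_mono) (auto simp: L_def)
      finally show ?thesis .
    qed
    have "L \<ge> 0" by (simp add: L_def)
    have "bounded ((\<lambda>t. X 1 t - X 0 t) ` {t0..T})"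
      by (intro compact_imp_bounded compact_continuous_image continuous_on_diff contX) auto
    then obtain C where C: "\<And>t. t \<in> {t0..T} \<Longrightarrow> norm (X 1 t - X 0 t) \<le> C"
      unfolding bounded_iff by blast
    have "C \<ge> 0" using order_trans[OF norm_ge_zero C[of t0]] True by simp
    have bound: "norm (X (Suc n) t - X n t) \<le> C * (L * (t - t0)) ^ n / fact n"
      if "t \<in> {t0..T}" for n t
      using that
    proof (induction n arbitrary: t)
      case (Suc n)
      have sub: "{t0..t} \<subseteq> {t0..T}" using Suc.prems by auto
      have int: "(\<lambda>s. f s (X k s)) integrable_on {t0..t}" for k
        by (intro integrable_continuous_real contf contX) auto
      \<comment> \<open>The bound for index \<open>Suc n\<close> is a primitive of \<open>L\<close>
        times the bound for index \<open>n\<close>; this carries the induction.\<close>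
      have deriv: "((\<lambda>s. C * L ^ Suc n * (s - t0) ^ Suc n / fact (Suc n)) has_vector_derivative
          L * (C * (L * (s - t0)) ^ n / fact n)) (at s within {t0..t})" for s
      proof -
        have "((\<lambda>s. C * L ^ Suc n * (s - t0) ^ Suc n / fact (Suc n)) has_real_derivative
          C * L ^ Suc n * (of_nat (Suc n) * (s - t0) ^ n) / fact (Suc n)) (at s within {t0..t})"
          by (auto intro!: derivative_eq_intros simp del: fact_Suc power_Suc)
        moreover have "C * L ^ Suc n * (of_nat (Suc n) * d ^ n) / fact (Suc n)
            = L * (C * (L * d) ^ n / fact n)" for d
          by (simp add: power_mult_distrib field_simps del: of_nat_Suc)
        ultimately show ?thesis
          by (simp only: has_real_derivative_iff_has_vector_derivative)
      qed
      have hi: "((\<lambda>s. L * (C * (L * (s - t0)) ^ n / fact n)) has_integral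
          C * L ^ Suc n * (t - t0) ^ Suc n / fact (Suc n)
          - C * L ^ Suc n * (t0 - t0) ^ Suc n / fact (Suc n)) {t0..t}"
        by (rule fundamental_theorem_of_calculus) (use Suc.prems deriv in auto)
      have "X (Suc (Suc n)) t - X (Suc n) t
          = integral {t0..t} (\<lambda>s. f s (X (Suc n) s) - f s (X n s))"
        by (simp add: XS[of "Suc n" t] XS[of n t] integral_diff[OF int int])
      also have "norm \<dots> \<le> integral {t0..t} (\<lambda>s. L * (C * (L * (s - t0)) ^ n / fact n))"
      proof (rule integral_norm_bound_integral)
        show "(\<lambda>s. f s (X (Suc n) s) - f s (X n s)) integrable_on {t0..t}"
          by (intro integrable_diff int)
        show "(\<lambda>s. L * (C * (L * (s - t0)) ^ n / fact n)) integrable_on {t0..t}"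
          using hi by (rule has_integral_integrable)
        fix s assume "s \<in> {t0..t}"
        then have s: "s \<in> {t0..T}" using sub by auto
        have "norm (f s (X (Suc n) s) - f s (X n s)) \<le> L * norm (X (Suc n) s - X n s)"
          using L[OF s] .
        also have "\<dots> \<le> L * (C * (L * (s - t0)) ^ n / fact n)"
          using Suc.IH[OF s] \<open>L \<ge> 0\<close> by (intro mult_left_mono) auto
        finally show "norm (f s (X (Suc n) s) - f s (X n s)) \<le> \<dots>" .
      qed
      also have "\<dots> = C * (L * (t - t0)) ^ Suc n / fact (Suc n)"
        using integral_unique[OF hi] by (simp add: power_mult_distrib)
      finally show ?case .
    qed (use C in simp)
    \<comment> \<open>The increments telescope to the iterates and are majorised by the exponential
      series at \<open>L * (T - t0)\<close>.\<close>
    have "uniformly_convergent_on {t0..T} (\<lambda>n t. \<Sum>k<n. X (Suc k) t - X k t)"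
    proof (rule Weierstrass_m_test')
      fix n t assume t: "t \<in> {t0..T}"
      have "norm (X (Suc n) t - X n t) \<le> C * (L * (t - t0)) ^ n / fact n" by (rule bound[OF t])
      also have "\<dots> \<le> C * (L * (T - t0)) ^ n / fact n"
        using t \<open>C \<ge> 0\<close> \<open>L \<ge> 0\<close>
        by (intro divide_right_mono mult_left_mono power_mono) auto
      also have "\<dots> = C * ((L * (T - t0)) ^ n /\<^sub>R fact n)" by (simp add: divide_inverse_commute)
      finally show "norm (X (Suc n) t - X n t) \<le> \<dots>" .
    next
      show "summable (\<lambda>n. C * ((L * (T - t0)) ^ n /\<^sub>R fact n))"
        by (intro summable_mult summable_exp_generic)
    qed
    then obtain l where "uniform_limit {t0..T} (\<lambda>n t. \<Sum>k<n. X (Suc k) t - X k t) l sequentially"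
      unfolding uniformly_convergent_on_def by blast
    then have "uniform_limit {t0..T} (\<lambda>n t. x0 + (\<Sum>k<n. X (Suc k) t - X k t))
        (\<lambda>t. x0 + l t) sequentially"
      by (intro uniform_limit_add uniform_limit_const)
    moreover have "x0 + (\<Sum>k<n. X (Suc k) t - X k t) = X n t" for n t
      using sum_lessThan_telescope[of "\<lambda>k. X k t" n] by (simp add: X0)
    ultimately have "uniform_limit {t0..T} X (\<lambda>t. x0 + l t) sequentially" by simp
    then have "uniformly_convergent_on {t0..T} X"
      unfolding uniformly_convergent_on_def by blast
    then show ?thesis by (simp add: uniformly_convergent_uniform_limit_iff)
  qed auto
  define x where "x t = lim (\<lambda>n. X n t)" for t
  have ul: "uniform_limit {t0..T} X x sequentially" for T
    using lim[of T] unfolding x_def .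
  have contx: "continuous_on {t0..T} x" for T
    by (rule uniform_limit_theorem[OF _ ul]) (simp_all add: contX)
  have eq: "x t = x0 + integral {t0..t} (\<lambda>s. f s (x s))" if t: "t \<ge> t0" for t
  proof -
    obtain L where L: "\<forall>s\<in>{t0..t}. \<forall>x y. norm (f s x - f s y) \<le> L * norm (x - y)"
      using lip[OF t] by blast
    \<comment> \<open>The Lipschitz bound transfers uniform convergence to the integrands, so the
      recursion \<open>XS\<close> passes to the limit. The constant is enlarged to
      \<open>\<bar>L\<bar> + 1\<close> to have a positive divisor.\<close>
    have "uniform_limit {t0..t} (\<lambda>n s. f s (X n s)) (\<lambda>s. f s (x s)) sequentially"
    proof (rule uniform_limitI)
      fix e :: real assume "e > 0"
      then have "e / (\<bar>L\<bar> + 1) > 0" by simp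
      from uniform_limitD[OF ul[of t] this]
      show "\<forall>\<^sub>F n in sequentially. \<forall>s\<in>{t0..t}. dist (f s (X n s)) (f s (x s)) < e"
      proof eventually_elim
        case (elim n)
        show ?case
        proof
          fix s assume s: "s \<in> {t0..t}"
          have "dist (f s (X n s)) (f s (x s)) \<le> L * norm (X n s - x s)"
            using L s by (simp add: dist_norm)
          also have "\<dots> \<le> (\<bar>L\<bar> + 1) * norm (X n s - x s)" by (intro mult_right_mono) auto
          also have "\<dots> < e" using elim s by (simp add: dist_norm field_simps)
          finally show "dist (f s (X n s)) (f s (x s)) < e" .
        qed
      qed
    qed
    then obtain I J where I: "\<And>n. ((\<lambda>s. f s (X n s)) has_integral I n) {t0..t}"
      and J: "((\<lambda>s. f s (x s)) has_integral J) {t0..t}" and "I \<longlonglongrightarrow> J"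
    proof (rule uniform_limit_integral)
      show "continuous_on {t0..t} (\<lambda>s. f s (X n s))" for n by (intro contf contX) auto
    qed auto
    then have "(\<lambda>n. x0 + I n) \<longlonglongrightarrow> x0 + J" by (intro tendsto_intros)
    moreover have "x0 + I n = X (Suc n) t" for n using integral_unique[OF I] by (simp add: XS)
    moreover have "(\<lambda>n. X (Suc n) t) \<longlonglongrightarrow> x t"
      using tendsto_uniform_limitI[OF ul[of t], of t] t by (intro LIMSEQ_Suc) auto
    ultimately have "x t = x0 + J" by (simp add: LIMSEQ_unique)
    then show ?thesis using integral_unique[OF J] by simp
  qed
  have contx': "continuous_on {t0..} x"
    unfolding continuous_on_eq_continuous_within
  proof
    fix t assume "t \<in> {t0..}"
    then have "continuous (at t within {t0..t+1}) x"
      using contx[of "t+1"] by (auto simp: continuous_on_eq_continuous_within)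
    then show "continuous (at t within {t0..}) x"
      by (simp add: at_within_atLeast_eq_Icc[of t "t+1"])
  qed
  show ?thesis
  proof (intro exI[of _ x] conjI allI impI)
    show "x t0 = x0" using eq[of t0] by simp
    fix t assume t: "t \<ge> t0"
    have "((\<lambda>t. x0 + integral {t0..t} (\<lambda>s. f s (x s))) has_vector_derivative 0 + f t (x t))
        (at t within {t0..})"
      by (intro has_vector_derivative_add has_vector_derivative_const
          integral_has_vector_derivative_atLeast contf contx' t) auto
    then have "((\<lambda>t. x0 + integral {t0..t} (\<lambda>s. f s (x s))) has_vector_derivative f t (x t))
        (at t within {t0..})" by (simp only: add_0)
    from has_vector_derivative_transform[OF _ eq this]
    show "(x has_vector_derivative f t (x t)) (at t within {t0..})"
      using t by auto
  qed
qed

text \<open>The equation becomes a first-order system for the solution and \<open>p\<close> times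
  its derivative, so that \<open>p\<close> needs only continuity. The system is linear with
  coefficients bounded on compact intervals, and the initial value (1, 0) makes the solution
  nontrivial.\<close>

lemma linear_solution_exists:
  assumes p: "continuous_on {t0..} p" and q: "continuous_on {t0..} q"
    and r: "continuous_on {t0..} r" and p_pos: "\<And>t. t \<ge> t0 \<Longrightarrow> p t > 0"
  shows "\<exists>\<psi>. is_solution t0 (\<lambda>t w. p t) (\<lambda>t w. q t) (\<lambda>t w. r t) \<psi> \<and> nontrivial_on {t0..} \<psi>"
proof -
  define f :: "real \<Rightarrow> real \<times> real \<Rightarrow> real \<times> real"
    where "f t x = (snd x / p t, - (q t / p t) * snd x - r t * fst x)" for t x
  have "\<exists>x. x t0 = (1, 0) \<and> (\<forall>t\<ge>t0. (x has_vector_derivative f t (x t)) (at t within {t0..}))"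
  proof (rule picard_global_existence)
    have "continuous_on ({t0..} \<times> UNIV) (\<lambda>x :: real \<times> real \<times> real. h (fst x))"
      if "continuous_on {t0..} h" for h :: "real \<Rightarrow> real"
      by (rule continuous_on_compose2[OF that]) (auto intro!: continuous_intros)
    then show "continuous_on ({t0..} \<times> UNIV) (\<lambda>(t, x). f t x)"
      unfolding f_def split_beta
      using p q r by (intro continuous_intros) (auto dest: p_pos)
    fix T assume "T \<ge> t0"
    \<comment> \<open>The summands are the absolute values of the entries of the system matrix at
      time \<open>t\<close>, so \<open>h t\<close> is a Lipschitz constant at that time.\<close>
    define h where "h t = 1 / p t + \<bar>q t / p t\<bar> + \<bar>r t\<bar>" for t
    have "continuous_on {t0..T} h"
      unfolding h_def using p_pos
      by (intro continuous_intros continuous_on_subset[OF p] continuous_on_subset[OF q]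
          continuous_on_subset[OF r]) force+
    then have "bounded (h ` {t0..T})"
      by (intro compact_imp_bounded compact_continuous_image) auto
    then obtain L where L: "\<And>t. t \<in> {t0..T} \<Longrightarrow> norm (h t) \<le> L"
      unfolding bounded_iff by blast
    have "norm (f t x - f t y) \<le> L * norm (x - y)" if t: "t \<in> {t0..T}" for t x y
    proof -
      define u v where "u = fst x - fst y" and "v = snd x - snd y"
      have uv: "\<bar>u\<bar> \<le> norm (x - y)" "\<bar>v\<bar> \<le> norm (x - y)"
        using norm_fst_le[of u v] norm_snd_le[of v u]
        by (simp_all add: u_def v_def flip: fst_diff snd_diff)
      have "f t x - f t y = (v / p t, - (q t / p t) * v - r t * u)"
        by (simp add: f_def u_def v_def algebra_simps diff_divide_distrib)
      then have "norm (f t x - f t y) \<le> \<bar>v / p t\<bar> + \<bar>- (q t / p t) * v - r t * u\<bar>"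
        using norm_Pair_le[of "v / p t" "- (q t / p t) * v - r t * u"] by simp
      also have "\<dots> \<le> (1 / p t) * \<bar>v\<bar> + \<bar>q t / p t\<bar> * \<bar>v\<bar> + \<bar>r t\<bar> * \<bar>u\<bar>"
        using p_pos[of t] t abs_triangle_ineq4[of "- (q t / p t) * v" "r t * u"]
        by (simp add: abs_mult)
      also have "\<dots> \<le> (1 / p t) * norm (x - y) + \<bar>q t / p t\<bar> * norm (x - y) + \<bar>r t\<bar> * norm (x - y)"
        using p_pos[of t] t uv by (intro add_mono mult_left_mono) auto
      also have "\<dots> = h t * norm (x - y)" by (simp add: h_def algebra_simps)
      also have "\<dots> \<le> L * norm (x - y)" using L[OF t] by (intro mult_right_mono) auto
      finally show ?thesis .
    qed
    then show "\<exists>L. \<forall>t\<in>{t0..T}. \<forall>x y. norm (f t x - f t y) \<le> L * norm (x - y)" by blast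
  qed
  then obtain x where x0: "x t0 = (1, 0)"
    and x: "\<And>t. t \<ge> t0 \<Longrightarrow> (x has_vector_derivative f t (x t)) (at t within {t0..})" by blast
  have x1: "((\<lambda>t. fst (x t)) has_real_derivative snd (x t) / p t) (at t within {t0..})"
    if "t \<ge> t0" for t
    using bounded_linear.has_vector_derivative[OF bounded_linear_fst x[OF that]]
    by (simp add: f_def has_real_derivative_iff_has_vector_derivative)
  have x2: "((\<lambda>t. snd (x t)) has_real_derivative - (q t / p t) * snd (x t) - r t * fst (x t))
      (at t within {t0..})" if "t \<ge> t0" for t
    using bounded_linear.has_vector_derivative[OF bounded_linear_snd x[OF that]]
    by (simp add: f_def has_real_derivative_iff_has_vector_derivative)
  have c: "continuous_on {t0..} (\<lambda>t. fst (x t))" "continuous_on {t0..} (\<lambda>t. snd (x t))"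
    using x1 x2 by (auto intro!: DERIV_continuous_on)
  have c1: "continuous_on {t0..} (\<lambda>t. snd (x t) / p t)"
    by (intro continuous_intros p c) (auto dest: p_pos)
  have c2: "continuous_on {t0..} (\<lambda>t. - (q t / p t) * snd (x t) - r t * fst (x t))"
    by (intro continuous_intros p q r c) (auto dest: p_pos)
  have "C1_on_with {t0..} (\<lambda>t. p t * (snd (x t) / p t))
      (\<lambda>t. - (q t / p t) * snd (x t) - r t * fst (x t))"
    unfolding C1_on_with_def
  proof (intro conjI ballI c2)
    fix t assume t: "t \<in> {t0..}"
    show "((\<lambda>t. p t * (snd (x t) / p t)) has_real_derivative
        - (q t / p t) * snd (x t) - r t * fst (x t)) (at t within {t0..})"
      by (rule has_field_derivative_transform_within[OF x2 zero_less_one])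
         (use t in \<open>auto dest: p_pos\<close>)
  qed
  then have "is_solution t0 (\<lambda>t w. p t) (\<lambda>t w. q t) (\<lambda>t w. r t) (\<lambda>t. fst (x t))"
    unfolding is_solution_def
    by (intro exI[of _ "\<lambda>t. snd (x t) / p t"]
        exI[of _ "\<lambda>t. - (q t / p t) * snd (x t) - r t * fst (x t)"])
       (use x1 c1 in \<open>auto simp: C1_on_with_def\<close>)
  moreover have "nontrivial_on {t0..} (\<lambda>t. fst (x t))"
    by (auto simp: nontrivial_on_def x0 intro!: bexI[of _ t0])
  ultimately show ?thesis by blast
qed

section \<open>Sturm comparison by Picone's identity and the Riccati inequality\<close>

text \<open>Here \<open>y = a \<phi>'\<close> and \<open>g\<close> stands for the quotient \<open>q / a\<close> of the equation
  \<open>(a \<phi>')' + q \<phi>' + c \<phi> = 0\<close>.\<close>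

locale sturm_system =
  fixes t0 :: real and a g c \<phi> y :: "real \<Rightarrow> real"
  assumes a_cont: "continuous_on {t0..} a" and g_cont: "continuous_on {t0..} g"
    and a_pos: "t \<ge> t0 \<Longrightarrow> a t > 0"
    and phi_deriv: "t \<ge> t0 \<Longrightarrow> (\<phi> has_real_derivative y t / a t) (at t within {t0..})"
    and y_deriv: "t \<ge> t0 \<Longrightarrow> (y has_real_derivative - (g t * y t) - c t * \<phi> t) (at t within {t0..})"
begin

lemma phi_cont: "continuous_on {t0..} \<phi>"
  using phi_deriv by (auto intro!: DERIV_continuous_on)

lemma y_cont: "continuous_on {t0..} y"
  using y_deriv by (auto intro!: DERIV_continuous_on)

text \<open>The nonlinear equation need not be symmetric under negation, but with frozen
  coefficients the system is linear. Negative solutions thus reduce to positive ones.\<close>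

lemma sturm_system_minus: "sturm_system t0 a g c (\<lambda>t. - \<phi> t) (\<lambda>t. - y t)"
  by unfold_locales
     (auto simp: a_cont g_cont a_pos intro!: derivative_eq_intros phi_deriv y_deriv)

text \<open>Picone's identity: \<open>(\<phi> (y - u \<phi>) \<mu>)' \<ge> (y - u \<phi>)\<^sup>2 \<mu> / a\<close> with the integrating factor
  \<open>\<mu> = exp (\<integral> g)\<close>, so between two zeros of \<open>\<phi>\<close> one has \<open>y = u \<phi>\<close>.\<close>

lemma zero_between_zeros_if_riccati:
  assumes "t0 \<le> \<alpha>" "\<alpha> \<le> t" "t \<le> \<beta>" and zero: "\<phi> \<alpha> = 0" "\<phi> \<beta> = 0"
    and u: "\<And>\<tau>. \<tau> \<in> {\<alpha>..\<beta>} \<Longrightarrow> (u has_real_derivative u' \<tau>) (at \<tau> within {\<alpha>..\<beta>})"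
    and riccati: "\<And>\<tau>. \<tau> \<in> {\<alpha>..\<beta>} \<Longrightarrow> u' \<tau> \<le> - ((u \<tau>)\<^sup>2 / a \<tau>) - g \<tau> * u \<tau> - c \<tau>"
  shows "\<phi> t = 0"
proof -
  have sub: "{\<alpha>..\<beta>} \<subseteq> {t0..}" using assms by auto
  define m where "m \<tau> = exp (integral {t0..\<tau>} g)" for \<tau>
  have m: "(m has_real_derivative g \<tau> * m \<tau>) (at \<tau> within {t0..})" if "\<tau> \<ge> t0" for \<tau>
    unfolding m_def using integral_has_real_derivative_atLeast[OF g_cont that]
    by (auto intro!: derivative_eq_intros)
  have m_pos: "m \<tau> > 0" for \<tau> by (simp add: m_def)
  define G where "G \<tau> = \<phi> \<tau> * (y \<tau> - u \<tau> * \<phi> \<tau>) * m \<tau>" for \<tau>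
  define H where "H \<tau> = (y \<tau> / a \<tau> * (y \<tau> - u \<tau> * \<phi> \<tau>) + \<phi> \<tau> * (- (g \<tau> * y \<tau>) - c \<tau> * \<phi> \<tau>
      - (u' \<tau> * \<phi> \<tau> + u \<tau> * (y \<tau> / a \<tau>))) + g \<tau> * \<phi> \<tau> * (y \<tau> - u \<tau> * \<phi> \<tau>)) * m \<tau>" for \<tau>
  have G: "(G has_real_derivative H \<tau>) (at \<tau> within {\<alpha>..\<beta>})" if \<tau>: "\<tau> \<in> {\<alpha>..\<beta>}" for \<tau>
  proof -
    have t0: "\<tau> \<ge> t0" using \<tau> sub by auto
    note d = DERIV_subset[OF phi_deriv[OF t0] sub] DERIV_subset[OF y_deriv[OF t0] sub]
      DERIV_subset[OF m[OF t0] sub] u[OF \<tau>]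
    show ?thesis unfolding G_def H_def
      by (rule derivative_eq_intros d refl)+ (simp add: algebra_simps)
  qed
  have H: "H \<tau> \<ge> (y \<tau> - u \<tau> * \<phi> \<tau>)\<^sup>2 / a \<tau> * m \<tau>" if \<tau>: "\<tau> \<in> {\<alpha>..\<beta>}" for \<tau>
  proof -
    have "u' \<tau> * (\<phi> \<tau>)\<^sup>2 \<le> (- ((u \<tau>)\<^sup>2 / a \<tau>) - g \<tau> * u \<tau> - c \<tau>) * (\<phi> \<tau>)\<^sup>2"
      by (intro mult_right_mono riccati \<tau>) auto
    moreover have "y \<tau> / a \<tau> * (y \<tau> - u \<tau> * \<phi> \<tau>)
        + \<phi> \<tau> * (- (g \<tau> * y \<tau>) - c \<tau> * \<phi> \<tau> - (u' \<tau> * \<phi> \<tau> + u \<tau> * (y \<tau> / a \<tau>)))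
        + g \<tau> * \<phi> \<tau> * (y \<tau> - u \<tau> * \<phi> \<tau>)
      = (y \<tau> - u \<tau> * \<phi> \<tau>)\<^sup>2 / a \<tau>
        + ((- ((u \<tau>)\<^sup>2 / a \<tau>) - g \<tau> * u \<tau> - c \<tau>) * (\<phi> \<tau>)\<^sup>2 - u' \<tau> * (\<phi> \<tau>)\<^sup>2)"
      by (simp add: divide_inverse power2_eq_square algebra_simps)
    ultimately have "(y \<tau> - u \<tau> * \<phi> \<tau>)\<^sup>2 / a \<tau> \<le> y \<tau> / a \<tau> * (y \<tau> - u \<tau> * \<phi> \<tau>)
        + \<phi> \<tau> * (- (g \<tau> * y \<tau>) - c \<tau> * \<phi> \<tau> - (u' \<tau> * \<phi> \<tau> + u \<tau> * (y \<tau> / a \<tau>)))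
        + g \<tau> * \<phi> \<tau> * (y \<tau> - u \<tau> * \<phi> \<tau>)" by linarith
    then show ?thesis unfolding H_def
      by (intro mult_right_mono less_imp_le[OF m_pos])
  qed
  have Hnn: "H \<tau> \<ge> 0" if "\<tau> \<in> {\<alpha>..\<beta>}" for \<tau>
    by (rule order_trans[OF _ H[OF that]])
       (use that sub m_pos[of \<tau>] a_pos[of \<tau>] in \<open>auto simp: zero_le_mult_iff\<close>)
  have mono: "G \<sigma> \<le> G \<tau>" if "\<alpha> \<le> \<sigma>" "\<sigma> \<le> \<tau>" "\<tau> \<le> \<beta>" for \<sigma> \<tau>
    by (rule deriv_nonneg_imp_le[of _ _ _ H])
       (use that in \<open>auto intro!: Hnn DERIV_subset[OF G]\<close>)
  \<comment> \<open>\<open>G\<close> is nondecreasing and vanishes at both ends because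
    \<open>\<phi>\<close> does. Being constant, it has derivative 0, and the lower bound for
    \<open>H\<close> then forces the square to vanish.\<close>
  have G0: "G \<tau> = 0" if "\<tau> \<in> {\<alpha>..\<beta>}" for \<tau>
    using mono[of \<alpha> \<tau>] mono[of \<tau> \<beta>] that zero by (auto simp: G_def)
  have y: "y \<tau> = u \<tau> * \<phi> \<tau>" if "\<alpha> < \<tau>" "\<tau> < \<beta>" for \<tau>
  proof -
    have "(G has_real_derivative H \<tau>) (at \<tau>)"
      using G[of \<tau>] that by (simp add: at_within_Icc_at)
    moreover have "(G has_real_derivative 0) (at \<tau>)"
      by (rule has_field_derivative_transform_within_open[where f = "\<lambda>_. 0" and S = "{\<alpha><..<\<beta>}"])
         (use that G0 in auto)
    ultimately have "H \<tau> = 0" by (rule DERIV_unique)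
    with H[of \<tau>] that have "(y \<tau> - u \<tau> * \<phi> \<tau>)\<^sup>2 / a \<tau> * m \<tau> \<le> 0" by auto
    moreover have "a \<tau> > 0" using that a_pos[of \<tau>] assms(1) by auto
    ultimately show ?thesis using m_pos[of \<tau>]
      by (auto simp: mult_le_0_iff divide_le_0_iff)
  qed
  \<comment> \<open>With \<open>y = u \<phi>\<close> the system gives
    \<open>\<phi>' = (u / a) \<phi>\<close>. Starting from \<open>\<phi> \<alpha> = 0\<close>,
    Gronwall with \<open>k = 1\<close> and with \<open>k = -1\<close> bounds \<open>\<phi> t\<close>
    by 0 from both sides.\<close>
  have le: "f t \<le> f \<alpha> * exp (- integral {\<alpha>..t} (\<lambda>\<tau>. - (u \<tau> / a \<tau>)))"
    if f: "f = (\<lambda>\<tau>. k * \<phi> \<tau>)" for f k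
  proof (rule gronwall_decay[OF \<open>\<alpha> \<le> t\<close>])
    have "continuous_on {\<alpha>..\<beta>} u"
      using u by (intro DERIV_continuous_on) auto
    then have "continuous_on {\<alpha>..t} u"
      by (rule continuous_on_subset) (use assms(3) in auto)
    moreover have "continuous_on {\<alpha>..t} a"
      by (rule continuous_on_subset[OF a_cont]) (use assms(1) in auto)
    moreover have "\<forall>\<tau>\<in>{\<alpha>..t}. a \<tau> \<noteq> 0"
      using assms(1) order.strict_implies_not_eq[OF a_pos] by fastforce
    ultimately show "continuous_on {\<alpha>..t} (\<lambda>\<tau>. - (u \<tau> / a \<tau>))"
      by (intro continuous_intros)
    fix \<tau> assume \<tau>: "\<tau> \<in> {\<alpha>..t}"
    then have t0: "t0 \<le> \<tau>" "{\<alpha>..t} \<subseteq> {t0..}" using assms(1) by auto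
    show "(f has_real_derivative k * (y \<tau> / a \<tau>)) (at \<tau> within {\<alpha>..t})"
      unfolding f by (intro DERIV_cmult DERIV_subset[OF phi_deriv[OF t0(1)] t0(2)])
  qed (use y assms(3) in \<open>auto simp: f mult_ac\<close>)
  have "\<phi> t \<le> 0" using le[of _ 1] zero by auto
  moreover have "- \<phi> t \<le> 0" using le[of _ "-1"] zero by auto
  ultimately show ?thesis by simp
qed

end

text \<open>The witness is \<open>y = p \<phi>'\<close>. This serves both the nonlinear equation,
  with coefficients frozen along \<open>\<phi>\<close>, and the linear comparison equation, whose
  coefficients ignore the second argument.\<close>

lemma is_solution_imp_sturm_system:
  assumes "is_solution t0 p q r \<phi>"
    and "continuous_on {t0..} (\<lambda>t. p t (\<phi> t))" "continuous_on {t0..} (\<lambda>t. q t (\<phi> t))"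
    and pos: "\<And>t. t \<ge> t0 \<Longrightarrow> p t (\<phi> t) > 0"
  obtains y where "sturm_system t0 (\<lambda>t. p t (\<phi> t)) (\<lambda>t. q t (\<phi> t) / p t (\<phi> t)) (\<lambda>t. r t (\<phi> t)) \<phi> y"
proof -
  obtain d e where d: "C1_on_with {t0..} \<phi> d" "C1_on_with {t0..} (\<lambda>t. p t (\<phi> t) * d t) e"
    and eq: "\<And>t. t \<ge> t0 \<Longrightarrow> e t + q t (\<phi> t) * d t + r t (\<phi> t) * \<phi> t = 0"
    using assms(1) unfolding is_solution_def by blast
  have "sturm_system t0 (\<lambda>t. p t (\<phi> t)) (\<lambda>t. q t (\<phi> t) / p t (\<phi> t)) (\<lambda>t. r t (\<phi> t)) \<phi>
      (\<lambda>t. p t (\<phi> t) * d t)"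
  proof
    fix t assume t: "t \<ge> t0"
    note p = pos[OF t]
    show "(\<phi> has_real_derivative p t (\<phi> t) * d t / p t (\<phi> t)) (at t within {t0..})"
      using d(1) t p by (simp add: C1_on_with_def)
    have "e t = - (q t (\<phi> t) / p t (\<phi> t) * (p t (\<phi> t) * d t)) - r t (\<phi> t) * \<phi> t"
      using eq[OF t] p by (simp add: field_simps)
    then show "((\<lambda>t. p t (\<phi> t) * d t) has_real_derivative
        - (q t (\<phi> t) / p t (\<phi> t) * (p t (\<phi> t) * d t)) - r t (\<phi> t) * \<phi> t) (at t within {t0..})"
      using d(2) t by (metis C1_on_with_def atLeast_iff)
    show "p t (\<phi> t) > 0" by fact
  next
    show "continuous_on {t0..} (\<lambda>t. q t (\<phi> t) / p t (\<phi> t))"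
      by (intro continuous_intros assms) (use pos in force)
  qed (fact assms)
  then show ?thesis by (rule that)
qed

text \<open>An oscillatory solution has two zeros beyond \<open>s\<close> with a positive value
  between them, whereas the Riccati inequality on \<open>{s..}\<close> makes every solution vanish
  identically between two of its zeros there.\<close>

lemma not_oscillatory_if_riccati:
  assumes p: "continuous_on {t0..} p" and q: "continuous_on {t0..} q"
    and r: "continuous_on {t0..} r" and p_pos: "\<And>t. t \<ge> t0 \<Longrightarrow> p t > 0"
    and "t0 \<le> s"
    and u: "\<And>t. t \<ge> s \<Longrightarrow> (u has_real_derivative u' t) (at t within {s..})"
    and riccati: "\<And>t. t \<ge> s \<Longrightarrow> u' t \<le> - ((u t)\<^sup>2 / p t) - q t / p t * u t - r t"
  shows "\<not> linear_equation_oscillatory t0 p q r"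
proof
  assume osc: "linear_equation_oscillatory t0 p q r"
  obtain \<psi> where \<psi>: "is_solution t0 (\<lambda>t w. p t) (\<lambda>t w. q t) (\<lambda>t w. r t) \<psi>"
      "nontrivial_on {t0..} \<psi>"
    using linear_solution_exists[OF p q r p_pos] by auto
  have change: "changes_sign_on {T<..} \<psi>" if "T \<ge> t0" for T
    using osc \<psi> that unfolding linear_equation_oscillatory_def oscillatory_solution_def by blast
  obtain y where "sturm_system t0 p (\<lambda>t. q t / p t) r \<psi> y"
    using is_solution_imp_sturm_system[OF \<psi>(1) p q p_pos] by auto
  then interpret sturm_system t0 p "\<lambda>t. q t / p t" r \<psi> y .
  have zero: "\<exists>z>T. \<psi> z = 0" if T: "T \<ge> t0" for T
  proof -
    obtain \<sigma> \<tau> where \<sigma>\<tau>: "\<sigma> > T" "\<tau> > T" "\<psi> \<sigma> < 0" "0 < \<psi> \<tau>"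
      using change[OF T] by (auto simp: changes_sign_on_def)
    have "connected (\<psi> ` {T<..})"
      using T by (intro connected_continuous_image continuous_on_subset[OF phi_cont]) auto
    then have "0 \<in> \<psi> ` {T<..}"
      by (rule connectedD_interval[of _ "\<psi> \<sigma>" "\<psi> \<tau>"]) (use \<sigma>\<tau> in auto)
    then show ?thesis by auto
  qed
  obtain \<alpha> where \<alpha>: "\<alpha> > s" "\<psi> \<alpha> = 0" using zero[of s] assms(5) by auto
  obtain t where t: "t > \<alpha>" "\<psi> t > 0"
    using change[of \<alpha>] \<alpha> assms(5) by (auto simp: changes_sign_on_def)
  obtain \<beta> where \<beta>: "\<beta> > t" "\<psi> \<beta> = 0" using zero[of t] t \<alpha> assms(5) by auto
  have "\<psi> t = 0"
    by (rule zero_between_zeros_if_riccati[of \<alpha> t \<beta> u u'])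
       (use \<alpha> t \<beta> assms(5) riccati in \<open>auto intro!: DERIV_subset[OF u]\<close>)
  with t show False by simp
qed

text \<open>\<open>F\<close> is the inner integral of condition (C2). Its upper limit also enters
  the integrand; writing \<open>integral {s..t} q\<close> as \<open>I t - I s\<close> pulls this
  dependence out as the factor \<open>exp (- I t)\<close>, and the product rule applies.\<close>

lemma variation_of_constants_deriv:
  fixes q r :: "real \<Rightarrow> real"
  assumes q: "continuous_on {t0..} q" and r: "continuous_on {t0..} r" and "t0 \<le> t"
  defines "F \<equiv> \<lambda>t. integral {t0..t} (\<lambda>s. exp (- integral {s..t} q) * r s)"
  shows "(F has_real_derivative - (q t * F t) + r t) (at t within {t0..})"
proof -
  define I where "I t = integral {t0..t} q" for t
  have I: "(I has_real_derivative q t) (at t within {t0..})" if "t0 \<le> t" for t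
    unfolding I_def by (rule integral_has_real_derivative_atLeast[OF q that])
  have "continuous_on {t0..} I" using I by (auto intro!: DERIV_continuous_on)
  then have cont: "continuous_on {t0..} (\<lambda>s. exp (I s) * r s)" by (intro continuous_intros r)
  define J where "J t = integral {t0..t} (\<lambda>s. exp (I s) * r s)" for t
  have J: "(J has_real_derivative exp (I t) * r t) (at t within {t0..})"
    unfolding J_def by (rule integral_has_real_derivative_atLeast[OF cont \<open>t0 \<le> t\<close>])
  have F: "F t = exp (- I t) * J t" if "t0 \<le> t" for t
  proof -
    have "F t = integral {t0..t} (\<lambda>s. exp (- I t) * (exp (I s) * r s))"
      unfolding F_def
    proof (rule Henstock_Kurzweil_Integration.integral_cong)
      fix s assume "s \<in> {t0..t}"
      then have "- integral {s..t} q = - I t + I s"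
        using integral_split_real[OF q, of s t] by (simp add: I_def)
      then show "exp (- integral {s..t} q) * r s = exp (- I t) * (exp (I s) * r s)"
        by (simp only: exp_add mult.assoc)
    qed
    then show ?thesis by (simp add: J_def)
  qed
  have "((\<lambda>t. exp (- I t) * J t) has_real_derivative - (q t * F t) + r t) (at t within {t0..})"
    by (rule derivative_eq_intros I J \<open>t0 \<le> t\<close> refl)+
       (simp add: F[OF \<open>t0 \<le> t\<close>] exp_minus field_simps)
  then show ?thesis
    by (rule has_field_derivative_transform_within[OF _ zero_less_one])
       (use F \<open>t0 \<le> t\<close> in auto)
qed

section \<open>Propagation of signs when \<open>c\<close> is nonnegative\<close>

locale sturm_system_nonneg = sturm_system +
  assumes c_nonneg: "t \<ge> t0 \<Longrightarrow> c t \<ge> 0"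
begin

lemma sturm_system_nonneg_minus: "sturm_system_nonneg t0 a g c (\<lambda>t. - \<phi> t) (\<lambda>t. - y t)"
  by (intro sturm_system_nonneg.intro sturm_system_minus sturm_system_nonneg_axioms.intro c_nonneg)

text \<open>While \<open>\<phi> \<ge> 0\<close>, the term \<open>- c \<phi>\<close> can only push
  \<open>y\<close> down, so it may be dropped from the equation for \<open>y\<close>.\<close>

lemma y_le_exp:
  assumes "t0 \<le> s" "s \<le> t" and nn: "\<And>\<tau>. \<tau> \<in> {s..t} \<Longrightarrow> \<phi> \<tau> \<ge> 0"
  shows "y t \<le> y s * exp (- integral {s..t} g)"
proof (rule gronwall_decay[OF \<open>s \<le> t\<close>])
  show "continuous_on {s..t} g" by (rule continuous_on_subset[OF g_cont]) (use assms in auto)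
  fix \<tau> assume "\<tau> \<in> {s..t}"
  then show "(y has_real_derivative - (g \<tau> * y \<tau>) - c \<tau> * \<phi> \<tau>) (at \<tau> within {s..t})"
    by (intro DERIV_subset[OF y_deriv]) (use assms in auto)
next
  fix \<tau> assume "s < \<tau>" "\<tau> < t"
  then show "- (g \<tau> * y \<tau>) - c \<tau> * \<phi> \<tau> \<le> - (g \<tau> * y \<tau>)"
    using nn[of \<tau>] c_nonneg[of \<tau>] assms by simp
qed

text \<open>A nonnegative sign of \<open>y\<close> travels backwards in time: by the exponential
  bound from \<open>\<tau>\<close> to \<open>t\<close>, \<open>y t \<ge> 0\<close> forces
  \<open>y \<tau> \<ge> 0\<close>.\<close>

lemma phi_mono_if_y_nonneg:
  assumes "t0 \<le> s" "s \<le> t" "\<And>\<tau>. \<tau> \<in> {s..t} \<Longrightarrow> \<phi> \<tau> \<ge> 0" "y t \<ge> 0"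
  shows "\<phi> s \<le> \<phi> t"
proof (rule deriv_nonneg_imp_le[OF \<open>s \<le> t\<close>])
  fix \<tau> assume "\<tau> \<in> {s..t}"
  then show "(\<phi> has_real_derivative y \<tau> / a \<tau>) (at \<tau> within {s..t})"
    by (intro DERIV_subset[OF phi_deriv]) (use assms in auto)
next
  fix \<tau> assume \<tau>: "s < \<tau>" "\<tau> < t"
  have "0 \<le> y \<tau> * exp (- integral {\<tau>..t} g)"
    using y_le_exp[of \<tau> t] assms \<tau> by fastforce
  then show "y \<tau> / a \<tau> \<ge> 0"
    using a_pos[of \<tau>] assms \<tau> by (simp add: zero_le_mult_iff)
qed

lemma y_neg_persists:
  assumes "t0 \<le> s" "s \<le> t" "\<And>\<tau>. \<tau> \<in> {s..t} \<Longrightarrow> \<phi> \<tau> \<ge> 0"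
  shows "y s \<le> 0 \<Longrightarrow> y t \<le> 0" "y s < 0 \<Longrightarrow> y t < 0"
  using y_le_exp[OF assms] by (auto simp: mult_le_0_iff mult_less_0_iff intro: order_trans order.strict_trans1)

lemma phi_antimono_if_y_nonpos:
  assumes "t0 \<le> s" "s \<le> t" "\<And>\<tau>. \<tau> \<in> {s..t} \<Longrightarrow> \<phi> \<tau> \<ge> 0" "y s \<le> 0"
  shows "\<phi> t \<le> \<phi> s"
proof (rule deriv_nonpos_imp_le[OF \<open>s \<le> t\<close>])
  fix \<tau> assume "\<tau> \<in> {s..t}"
  then show "(\<phi> has_real_derivative y \<tau> / a \<tau>) (at \<tau> within {s..t})"
    by (intro DERIV_subset[OF phi_deriv]) (use assms in auto)
next
  fix \<tau> assume \<tau>: "s < \<tau>" "\<tau> < t"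
  have "y \<tau> \<le> 0" using y_neg_persists(1)[of s \<tau>] assms \<tau> by auto
  then show "y \<tau> / a \<tau> \<le> 0"
    using a_pos[of \<tau>] assms \<tau> by (simp add: divide_le_0_iff)
qed

section \<open>Solutions that vanish near infinity\<close>

text \<open>To the right of \<open>m\<close> the derivative \<open>y / a\<close> of
  \<open>\<phi>\<close> is 0, hence so is \<open>y\<close>. Continuity from the right carries both
  zeros to \<open>m\<close>, even if \<open>m = t0\<close>.\<close>

lemma zero_data_at_end_of_support:
  assumes "t0 \<le> m" and zero: "\<And>t. t > m \<Longrightarrow> \<phi> t = 0"
  shows "\<phi> m = 0" "y m = 0"
proof -
  have cl: "f m = 0" if "continuous_on {t0..} f" "\<And>t. t > m \<Longrightarrow> f t = 0" for f :: "real \<Rightarrow> real"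
  proof -
    have "continuous_on (closure {m<..}) f"
      by (rule continuous_on_subset[OF that(1)]) (use assms(1) in auto)
    from continuous_constant_on_closure[OF this, of 0 m] show ?thesis using that(2) by auto
  qed
  show "\<phi> m = 0" using cl[OF phi_cont] zero by auto
  have "y t = 0" if t: "t > m" for t
  proof -
    have "(\<phi> has_real_derivative y t / a t) (at t)"
      using phi_deriv[of t] at_within_atLeast_real[of t0 t] t assms(1) by simp
    moreover have "(\<phi> has_real_derivative 0) (at t)"
      by (rule has_field_derivative_transform_within_open[where f = "\<lambda>_. 0" and S = "{m<..}"])
         (use t zero in auto)
    ultimately have "y t / a t = 0" by (rule DERIV_unique)
    then show ?thesis using a_pos[of t] t assms(1) by auto
  qed
  then show "y m = 0" using cl[OF y_cont] by auto
qed

text \<open>Otherwise \<open>\<phi>\<close> would be nonnegative on \<open>{\<sigma>..m}\<close>,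
  and \<open>y m = 0\<close> would make it nondecreasing there, up to
  \<open>\<phi> m = 0\<close>.\<close>

lemma negative_later_if_eventually_zero:
  assumes "t0 \<le> \<sigma>" "\<sigma> < m" "\<phi> \<sigma> > 0" and zero: "\<And>t. t > m \<Longrightarrow> \<phi> t = 0"
  shows "\<exists>\<tau>>\<sigma>. \<phi> \<tau> < 0"
proof (rule ccontr)
  assume "\<not> ?thesis"
  then have "\<phi> \<tau> \<ge> 0" if "\<tau> \<in> {\<sigma>..m}" for \<tau>
    using assms(3) that by (cases "\<tau> = \<sigma>") (auto simp: not_less dest: spec[of _ \<tau>])
  then have "\<phi> \<sigma> \<le> \<phi> m"
    using zero_data_at_end_of_support[OF _ zero] assms by (intro phi_mono_if_y_nonneg) auto
  then show False using zero_data_at_end_of_support[OF _ zero] assms by simp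
qed

text \<open>To the right of every point with \<open>\<phi> \<noteq> 0\<close> there is one of
  opposite sign, so sign changes can be chained without end; they stay below the supremum of the
  support.\<close>

lemma changes_sign_infinitely_often_if_eventually_zero:
  assumes nontriv: "nontrivial_on {t0..} \<phi>" and zero: "\<And>t. t > T \<Longrightarrow> \<phi> t = 0"
  shows "changes_sign_infinitely_often_on {t0..} \<phi>"
proof -
  define S where "S = {t. t \<ge> t0 \<and> \<phi> t \<noteq> 0}"
  have S: "S \<noteq> {}" using nontriv by (auto simp: S_def nontrivial_on_def)
  have bdd: "bdd_above S"
  proof (rule bdd_aboveI[of _ T])
    fix t assume "t \<in> S"
    then show "t \<le> T" using zero[of t] by (auto simp: S_def not_less[symmetric])
  qed
  define m where "m = Sup S"
  have m: "\<sigma> \<le> m" if "\<sigma> \<in> S" for \<sigma> using cSup_upper[OF that bdd] by (simp add: m_def)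
  obtain \<sigma> where "\<sigma> \<in> S" using S by blast
  then have "t0 \<le> m" using m[of \<sigma>] by (simp add: S_def)
  have zm: "\<phi> t = 0" if "t > m" for t
    using m[of t] that \<open>t0 \<le> m\<close> by (auto simp: S_def)
  interpret neg: sturm_system_nonneg t0 a g c "\<lambda>t. - \<phi> t" "\<lambda>t. - y t"
    by (rule sturm_system_nonneg_minus)
  have next_change: "\<exists>\<tau>. \<tau> \<in> S \<and> \<sigma> < \<tau> \<and> \<phi> \<sigma> * \<phi> \<tau> < 0" if \<sigma>: "\<sigma> \<in> S" for \<sigma>
  proof -
    \<comment> \<open>The inequality \<open>\<sigma> < m\<close> is strict because
      \<open>\<phi>\<close> vanishes at \<open>m\<close> but not at \<open>\<sigma>\<close>.\<close>
    have lt: "t0 \<le> \<sigma>" "\<sigma> < m" "\<phi> \<sigma> \<noteq> 0"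
      using \<sigma> m[OF \<sigma>] zero_data_at_end_of_support(1)[OF \<open>t0 \<le> m\<close> zm]
      by (auto simp: S_def order_le_less)
    then consider "\<phi> \<sigma> > 0" | "\<phi> \<sigma> < 0" by linarith
    then show ?thesis
    proof cases
      case 1
      obtain \<tau> where "\<tau> > \<sigma>" "\<phi> \<tau> < 0"
        using negative_later_if_eventually_zero[OF lt(1,2) 1 zm] by blast
      then show ?thesis
        using 1 lt(1) by (intro exI[of _ \<tau>]) (simp add: S_def mult_less_0_iff)
    next
      case 2
      obtain \<tau> where "\<tau> > \<sigma>" "\<phi> \<tau> > 0"
        using neg.negative_later_if_eventually_zero[OF lt(1,2)] 2 zm by auto
      then show ?thesis
        using 2 lt(1) by (intro exI[of _ \<tau>]) (simp add: S_def mult_less_0_iff)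
    qed
  qed
  \<comment> \<open>One infinite sequence provides the finite chains of every length
    \<open>n\<close> at once.\<close>
  have "\<exists>\<tau>. \<forall>n::nat. \<tau> n \<in> S \<and> (\<tau> n < \<tau> (Suc n) \<and> \<phi> (\<tau> n) * \<phi> (\<tau> (Suc n)) < 0)"
    by (rule dependent_nat_choice[of "\<lambda>_ t. t \<in> S" "\<lambda>_ s t. s < t \<and> \<phi> s * \<phi> t < 0"])
       (use S next_change in auto)
  then obtain \<tau> where "\<And>n. \<tau> n \<in> S" "\<And>n. \<tau> n < \<tau> (Suc n)" "\<And>n. \<phi> (\<tau> n) * \<phi> (\<tau> (Suc n)) < 0"
    by blast
  then show ?thesis
    unfolding changes_sign_infinitely_often_on_def by (intro allI exI[of _ \<tau>]) (auto simp: S_def)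
qed

section \<open>Solutions of constant sign near infinity\<close>

text \<open>A zero at \<open>t\<close> would be a local minimum, so \<open>y t = 0\<close>. From
  there \<open>\<phi>\<close> could not increase and would stay 0, against
  \<open>nz\<close>.\<close>

lemma positive_if_nonneg:
  assumes "t0 \<le> T" and nn: "\<And>t. t > T \<Longrightarrow> \<phi> t \<ge> 0"
    and nz: "\<And>T. \<exists>t>T. \<phi> t \<noteq> 0" and "t > T"
  shows "\<phi> t > 0"
proof (rule ccontr)
  assume "\<not> \<phi> t > 0"
  then have 0: "\<phi> t = 0" using nn[OF \<open>t > T\<close>] by simp
  have "(\<phi> has_real_derivative y t / a t) (at t)"
    using phi_deriv[of t] at_within_atLeast_real[of t0 t] assms by simp
  then have "y t / a t = 0"
    by (rule DERIV_local_min[of _ _ _ "t - T"]) (use 0 nn \<open>t > T\<close> in auto)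
  then have "y t = 0" using a_pos[of t] assms by auto
  obtain s where s: "s > t" "\<phi> s \<noteq> 0" using nz by blast
  have "\<phi> s \<le> \<phi> t"
    by (rule phi_antimono_if_y_nonpos) (use \<open>y t = 0\<close> s assms in auto)
  then show False using 0 s nn[of s] \<open>t > T\<close> by simp
qed

text \<open>The quotient \<open>u = y / \<phi>\<close> solves the Riccati equation with
  \<open>a\<close>, \<open>g\<close>, \<open>c\<close> exactly. Passing to \<open>p\<close>,
  \<open>q / p\<close>, \<open>r\<close> only enlarges the right-hand side; for the term with
  \<open>g\<close> this relies on \<open>u \<ge> 0\<close>.\<close>

lemma not_oscillatory_if_y_nonneg:
  assumes "t0 \<le> s" and pos: "\<And>t. t \<ge> s \<Longrightarrow> \<phi> t > 0" and y: "\<And>t. t \<ge> s \<Longrightarrow> y t \<ge> 0"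
    and p: "continuous_on {t0..} p" and q: "continuous_on {t0..} q"
    and r: "continuous_on {t0..} r" and p_pos: "\<And>t. t \<ge> t0 \<Longrightarrow> p t > 0"
    and le: "\<And>t. t \<ge> s \<Longrightarrow> a t \<le> p t" "\<And>t. t \<ge> s \<Longrightarrow> q t / p t \<le> g t"
      "\<And>t. t \<ge> s \<Longrightarrow> r t \<le> c t"
  shows "\<not> linear_equation_oscillatory t0 p q r"
proof (rule not_oscillatory_if_riccati[OF p q r p_pos \<open>t0 \<le> s\<close>])
  fix t assume t: "t \<ge> s"
  define u where "u t = y t / \<phi> t" for t
  define u' where "u' t = - ((u t)\<^sup>2 / a t) - g t * u t - c t" for t
  have t0: "t \<ge> t0" and sub: "{s..} \<subseteq> {t0..}" using t assms(1) by auto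
  have "((\<lambda>t. y t / \<phi> t) has_real_derivative u' t) (at t within {s..})"
    by (rule derivative_eq_intros DERIV_subset[OF phi_deriv[OF t0] sub]
        DERIV_subset[OF y_deriv[OF t0] sub] refl)+
       (use pos[OF t] a_pos[OF t0] in \<open>simp_all add: u'_def u_def field_simps power2_eq_square\<close>)
  then show "((\<lambda>t. y t / \<phi> t) has_real_derivative
      - ((y t / \<phi> t)\<^sup>2 / a t) - g t * (y t / \<phi> t) - c t) (at t within {s..})"
    by (simp add: u'_def u_def)
  have "u t \<ge> 0" using pos[OF t] y[OF t] by (simp add: u_def)
  then have "(u t)\<^sup>2 / p t \<le> (u t)\<^sup>2 / a t" "q t / p t * u t \<le> g t * u t"
    using le(1)[OF t] a_pos[OF t0] p_pos[OF t0] mult_right_mono[OF le(2)[OF t], of "u t"]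
    by (auto intro!: divide_left_mono)
  then show "- ((y t / \<phi> t)\<^sup>2 / a t) - g t * (y t / \<phi> t) - c t
      \<le> - ((y t / \<phi> t)\<^sup>2 / p t) - q t / p t * (y t / \<phi> t) - r t"
    using le(3)[OF t] by (simp add: u_def)
qed

text \<open>Since \<open>y < 0\<close>, the bound \<open>g \<le> Q\<close> gives exponential control
  of \<open>y\<close> with rate \<open>Q\<close>. Together with \<open>a \<le> P\<close> this makes
  \<open>\<phi>'\<close> at most \<open>- K\<close> times the divergent integrand of (C1).\<close>

lemma not_decreasing_while_small:
  assumes "t0 \<le> s" and nn: "\<And>t. t \<ge> s \<Longrightarrow> \<phi> t \<ge> 0" and ys: "y s < 0"
    and Q: "continuous_on {t0..} Q" and P_pos: "\<And>t. t \<ge> t0 \<Longrightarrow> P t > 0"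
    and le: "\<And>t. t \<ge> s \<Longrightarrow> a t \<le> P t" "\<And>t. t \<ge> s \<Longrightarrow> g t \<le> Q t"
    and inf: "improper_integral_infinite t0 (\<lambda>\<tau>. exp (- integral {t0..\<tau>} Q) * (1 / P \<tau>))"
  shows False
proof -
  have sub: "{s..} \<subseteq> {t0..}" using assms(1) by auto
  have y_neg: "y t < 0" if "t \<ge> s" for t
    using y_neg_persists(2)[of s t] that nn ys assms(1) by auto
  \<comment> \<open>The factor moves the base point of the exponent from \<open>s\<close> to
    \<open>t0\<close>, where the integrand of (C1) has it.\<close>
  define K where "K = - y s * exp (integral {t0..s} Q)"
  have "K > 0" using ys by (simp add: K_def mult_less_0_iff)
  have "\<exists>t\<ge>s. \<phi> t < 0"
  proof (rule unbounded_below_if_deriv_le[OF \<open>t0 \<le> s\<close> \<open>K > 0\<close> inf])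
    fix t assume t: "s \<le> t"
    then have t0: "t0 \<le> t" using assms(1) by auto
    show "(\<phi> has_real_derivative y t / a t) (at t within {s..})"
      by (rule DERIV_subset[OF phi_deriv[OF t0] sub])
    have "y t \<le> y s * exp (- integral {s..t} Q)"
    proof (rule gronwall_decay[OF t])
      show "continuous_on {s..t} Q" by (rule continuous_on_subset[OF Q]) (use assms(1) in auto)
      fix \<tau> assume "\<tau> \<in> {s..t}"
      then show "(y has_real_derivative - (g \<tau> * y \<tau>) - c \<tau> * \<phi> \<tau>) (at \<tau> within {s..t})"
        by (intro DERIV_subset[OF y_deriv]) (use assms(1) in auto)
    next
      fix \<tau> assume \<tau>: "s < \<tau>" "\<tau> < t"
      have "Q \<tau> * y \<tau> \<le> g \<tau> * y \<tau>"
        using le(2)[of \<tau>] y_neg[of \<tau>] \<tau> by (intro mult_right_mono_neg) auto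
      moreover have "0 \<le> c \<tau> * \<phi> \<tau>" using nn[of \<tau>] c_nonneg[of \<tau>] \<tau> assms(1) by auto
      ultimately show "- (g \<tau> * y \<tau>) - c \<tau> * \<phi> \<tau> \<le> - (Q \<tau> * y \<tau>)" by simp
    qed
    also have "- integral {s..t} Q = integral {t0..s} Q + - integral {t0..t} Q"
      using integral_split_real[OF Q \<open>t0 \<le> s\<close> t] by simp
    also have "y s * exp \<dots> = - (K * exp (- integral {t0..t} Q))"
      by (simp only: exp_add K_def)
    finally have "y t / P t \<le> - (K * exp (- integral {t0..t} Q)) / P t"
      using P_pos[OF t0] by (intro divide_right_mono) auto
    moreover have "y t / a t \<le> y t / P t"
      using le(1)[OF t] a_pos[OF t0] P_pos[OF t0] y_neg[OF t] by (intro divide_left_mono_neg) auto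
    ultimately show "y t / a t \<le> - (K * (exp (- integral {t0..t} Q) * (1 / P t)))" by simp
  qed
  then show False using nn by force
qed

text \<open>\<open>F\<close> solves \<open>F' = - q F + r\<close>, so \<open>y + N F\<close> obeys the homogeneous inequality. Its initial
  value \<open>Z\<close> may be positive, but \<open>y t \<le> y s exp (- \<integral> q)\<close> already bounds \<open>E = \<integral> exp (- \<integral> q) / p\<close>,
  so the term \<open>Z E\<close> cannot prevent \<open>\<phi>\<close> from becoming negative.\<close>

lemma not_decreasing_while_large:
  assumes "t0 \<le> s" "N > 0" and ge: "\<And>t. t \<ge> s \<Longrightarrow> \<phi> t \<ge> N" and ys: "y s < 0"
    and p: "continuous_on {t0..} p" and q: "continuous_on {t0..} q"
    and r: "continuous_on {t0..} r" and p_pos: "\<And>t. t \<ge> t0 \<Longrightarrow> p t > 0"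
    and le: "\<And>t. t \<ge> s \<Longrightarrow> a t \<le> p t" "\<And>t. t \<ge> s \<Longrightarrow> g t \<le> q t"
      "\<And>t. t \<ge> s \<Longrightarrow> r t \<le> c t"
    and inf: "improper_integral_infinite t0 (\<lambda>\<tau>. (1 / p \<tau>) *
        integral {t0..\<tau>} (\<lambda>s. exp (- integral {s..\<tau>} q) * r s))"
  shows False
proof -
  have sub: "{s..} \<subseteq> {t0..}" using assms(1) by auto
  have nn: "\<phi> t \<ge> 0" if "t \<ge> s" for t using ge[OF that] \<open>N > 0\<close> by simp
  have y_neg: "y t < 0" if "t \<ge> s" for t
    using y_neg_persists(2)[of s t] that nn ys assms(1) by auto
  define F where "F t = integral {t0..t} (\<lambda>s. exp (- integral {s..t} q) * r s)" for t
  have F: "(F has_real_derivative - (q t * F t) + r t) (at t within {t0..})" if "t0 \<le> t" for t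
    using variation_of_constants_deriv[OF q r that] by (simp add: F_def[abs_def])
  define X where "X t = exp (- integral {s..t} q)" for t
  \<comment> \<open>Gronwall with rate \<open>q\<close>, shared by \<open>y\<close> and by
    \<open>y + N F\<close>.\<close>
  have decay: "Y t \<le> Y s * X t"
    if t: "s \<le> t" and Y: "\<And>\<tau>. \<tau> \<ge> t0 \<Longrightarrow> (Y has_real_derivative Y' \<tau>) (at \<tau> within {t0..})"
      and Y': "\<And>\<tau>. s < \<tau> \<Longrightarrow> Y' \<tau> \<le> - (q \<tau> * Y \<tau>)" for Y Y' t
    unfolding X_def
  proof (rule gronwall_decay[OF t])
    show "continuous_on {s..t} q" by (rule continuous_on_subset[OF q]) (use assms(1) in auto)
    fix \<tau> assume "\<tau> \<in> {s..t}"
    then show "(Y has_real_derivative Y' \<tau>) (at \<tau> within {s..t})"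
      by (intro DERIV_subset[OF Y]) (use assms(1) in auto)
  qed (use Y' in auto)
  have qy: "q \<tau> * y \<tau> \<le> g \<tau> * y \<tau>" if "s < \<tau>" for \<tau>
    using le(2)[of \<tau>] y_neg[of \<tau>] that by (intro mult_right_mono_neg) auto
  have y_decay: "y t \<le> y s * X t" if "s \<le> t" for t
  proof (rule decay[OF that y_deriv])
    fix \<tau> assume "s < \<tau>"
    then show "- (g \<tau> * y \<tau>) - c \<tau> * \<phi> \<tau> \<le> - (q \<tau> * y \<tau>)"
      using qy[of \<tau>] nn[of \<tau>] c_nonneg[of \<tau>] assms(1)
      by (smt (verit) mult_nonneg_nonneg)
  qed
  define Z where "Z = y s + N * F s"
  have z_decay: "y t + N * F t \<le> Z * X t" if "s \<le> t" for t
    unfolding Z_def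
  proof (rule decay[OF that, of "\<lambda>t. y t + N * F t"
        "\<lambda>t. (- (g t * y t) - c t * \<phi> t) + N * (- (q t * F t) + r t)"])
    fix \<tau> assume "t0 \<le> \<tau>"
    then show "((\<lambda>t. y t + N * F t) has_real_derivative
        (- (g \<tau> * y \<tau>) - c \<tau> * \<phi> \<tau>) + N * (- (q \<tau> * F \<tau>) + r \<tau>)) (at \<tau> within {t0..})"
      by (intro DERIV_add DERIV_cmult y_deriv F)
  next
    fix \<tau> assume \<tau>: "s < \<tau>"
    \<comment> \<open>\<open>r\<close> may be negative, so \<open>c \<ge> r\<close> is used first;
      then \<open>c \<ge> 0\<close> allows \<open>N\<close> to be replaced by
      \<open>\<phi> \<tau>\<close>.\<close>
    have "N * r \<tau> \<le> N * c \<tau>" using le(3)[of \<tau>] \<tau> \<open>N > 0\<close> by simp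
    also have "\<dots> \<le> \<phi> \<tau> * c \<tau>"
      using ge[of \<tau>] c_nonneg[of \<tau>] \<tau> assms(1) by (intro mult_right_mono) auto
    finally show "(- (g \<tau> * y \<tau>) - c \<tau> * \<phi> \<tau>) + N * (- (q \<tau> * F \<tau>) + r \<tau>)
        \<le> - (q \<tau> * (y \<tau> + N * F \<tau>))"
      using qy[OF \<tau>] by (simp add: algebra_simps)
  qed
  define k where "k t = X t / p t" for t
  have "continuous_on {s..} X"
    unfolding X_def using integral_has_real_derivative_atLeast[OF continuous_on_subset[OF q sub]]
    by (intro continuous_intros DERIV_continuous_on) auto
  moreover have "continuous_on {s..} p" by (rule continuous_on_subset[OF p sub])
  moreover have "\<forall>t\<in>{s..}. p t \<noteq> 0"
    using assms(1) order.strict_implies_not_eq[OF p_pos] by fastforce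
  ultimately have k_cont: "continuous_on {s..} k"
    unfolding k_def by (intro continuous_intros)
  have k_nn: "k t \<ge> 0" if "t \<ge> s" for t
    using p_pos[of t] that assms(1) by (simp add: k_def X_def)
  define E where "E t = integral {s..t} k" for t
  have E: "(E has_real_derivative k t) (at t within {s..})" if "t \<ge> s" for t
    unfolding E_def by (rule integral_has_real_derivative_atLeast[OF k_cont that])
  have phi: "(\<phi> has_real_derivative y t / a t) (at t within {s..})" if "t \<ge> s" for t
    using DERIV_subset[OF phi_deriv sub] that assms(1) by auto
  have y_le: "y t / a t \<le> B / p t" if t: "t \<ge> s" "y t \<le> B" for B t
  proof -
    have t0: "t \<ge> t0" using t assms(1) by auto
    have "y t / a t \<le> y t / p t"
      using le(1)[OF t(1)] a_pos[OF t0] p_pos[OF t0] y_neg[OF t(1)]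
      by (intro divide_left_mono_neg) auto
    also have "\<dots> \<le> B / p t" using t(2) p_pos[OF t0] by (intro divide_right_mono) auto
    finally show ?thesis .
  qed
  have E_bounds: "0 \<le> E t" "E t \<le> \<phi> s / (- y s)" if t: "t \<ge> s" for t
  proof -
    show "0 \<le> E t" unfolding E_def
      using k_nn by (intro Henstock_Kurzweil_Integration.integral_nonneg
          integrable_continuous_real continuous_on_subset[OF k_cont]) auto
    \<comment> \<open>This difference is nonincreasing because \<open>y_decay\<close> gives
      \<open>y / a \<le> y s * k\<close>. With \<open>\<phi> t \<ge> 0\<close> and
      \<open>E s = 0\<close> it leaves \<open>- y s * E t \<le> \<phi> s\<close>.\<close>
    have "\<phi> t - y s * E t \<le> \<phi> s - y s * E s"
    proof (rule deriv_nonpos_imp_le[OF t, of _ "\<lambda>\<tau>. y \<tau> / a \<tau> - y s * k \<tau>"])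
      fix \<tau> assume "\<tau> \<in> {s..t}"
      then show "((\<lambda>\<tau>. \<phi> \<tau> - y s * E \<tau>) has_real_derivative y \<tau> / a \<tau> - y s * k \<tau>)
          (at \<tau> within {s..t})"
        by (intro DERIV_diff DERIV_cmult DERIV_subset[OF phi] DERIV_subset[OF E]) auto
    next
      fix \<tau> assume "s < \<tau>"
      then show "y \<tau> / a \<tau> - y s * k \<tau> \<le> 0"
        using y_le[OF _ y_decay, of \<tau>] by (simp add: k_def)
    qed
    then have "- y s * E t \<le> \<phi> s" using nn[OF t] by (simp add: E_def)
    then show "E t \<le> \<phi> s / (- y s)" using ys by (simp add: field_simps)
  qed
  \<comment> \<open>The threshold is minus an upper bound for \<open>Z * E t\<close>, so adding
    \<open>Z * E t\<close> back leaves \<open>\<phi> t\<close> negative.\<close>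
  have "\<exists>t\<ge>s. \<phi> t - Z * E t < - (\<bar>Z\<bar> * (\<phi> s / (- y s)))"
  proof (rule unbounded_below_if_deriv_le[OF \<open>t0 \<le> s\<close> \<open>N > 0\<close> inf])
    fix t assume t: "t \<ge> s"
    show "((\<lambda>t. \<phi> t - Z * E t) has_real_derivative y t / a t - Z * k t) (at t within {s..})"
      by (intro DERIV_diff DERIV_cmult phi E t)
    have "y t / a t \<le> (Z * X t - N * F t) / p t"
      using z_decay[OF t] by (intro y_le[OF t]) simp
    then show "y t / a t - Z * k t \<le> - (N * (1 / p t *
        integral {t0..t} (\<lambda>s. exp (- integral {s..t} q) * r s)))"
      by (simp add: k_def F_def diff_divide_distrib)
  qed
  then obtain t where t: "t \<ge> s" "\<phi> t - Z * E t < - (\<bar>Z\<bar> * (\<phi> s / (- y s)))" by blast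
  have "Z * E t \<le> \<bar>Z\<bar> * E t" using E_bounds(1)[OF t(1)] by (intro mult_right_mono) auto
  also have "\<dots> \<le> \<bar>Z\<bar> * (\<phi> s / (- y s))" using E_bounds(2)[OF t(1)] by (intro mult_left_mono) auto
  finally show False using t nn[OF t(1)] by linarith
qed

text \<open>Conditions (B) and (C) enter only through the absolute value of \<open>\<phi>\<close>,
  so the result applies to a solution and to its negative with the same frozen coefficients.\<close>

lemma not_eventually_positive:
  fixes p q r :: "real \<Rightarrow> real \<Rightarrow> real"
  assumes "t0 \<le> T" and pos: "\<And>t. t > T \<Longrightarrow> \<phi> t > 0"
    and Q: "continuous_on {t0..} Q" and P_pos: "\<And>t. t \<ge> t0 \<Longrightarrow> P t > 0"
    and p: "\<And>\<epsilon>. \<epsilon> > 0 \<Longrightarrow> continuous_on {t0..} (p \<epsilon>)"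
    and q: "\<And>\<epsilon>. \<epsilon> > 0 \<Longrightarrow> continuous_on {t0..} (q \<epsilon>)"
    and r: "\<And>\<epsilon>. \<epsilon> > 0 \<Longrightarrow> continuous_on {t0..} (r \<epsilon>)"
    and p_pos: "\<And>\<epsilon> t. \<epsilon> > 0 \<Longrightarrow> t \<ge> t0 \<Longrightarrow> p \<epsilon> t > 0"
    and "\<epsilon>0 > 0"
    and B: "\<And>\<epsilon> t. \<lbrakk>0 < \<epsilon>; \<epsilon> \<le> \<epsilon>0; t \<ge> t0; \<bar>\<phi> t\<bar> \<ge> \<epsilon>\<rbrakk> \<Longrightarrow>
        a t \<le> p \<epsilon> t \<and> g t \<ge> q \<epsilon> t / p \<epsilon> t \<and> c t \<ge> r \<epsilon> t"
    and osc: "\<And>\<epsilon>. \<lbrakk>0 < \<epsilon>; \<epsilon> \<le> \<epsilon>0\<rbrakk> \<Longrightarrow> linear_equation_oscillatory t0 (p \<epsilon>) (q \<epsilon>) (r \<epsilon>)"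
    and "N > 0"
    and C1: "\<And>t. \<lbrakk>t \<ge> t0; \<bar>\<phi> t\<bar> \<le> N\<rbrakk> \<Longrightarrow> a t \<le> P t \<and> g t \<le> Q t"
      "improper_integral_infinite t0 (\<lambda>\<tau>. exp (- integral {t0..\<tau>} Q) * (1 / P \<tau>))"
    and C2: "\<And>\<epsilon> t. \<lbrakk>\<epsilon> \<ge> N; t \<ge> t0; N \<le> \<bar>\<phi> t\<bar>; \<bar>\<phi> t\<bar> \<le> \<epsilon>\<rbrakk> \<Longrightarrow>
        a t \<le> p \<epsilon> t \<and> g t \<le> q \<epsilon> t \<and> c t \<ge> r \<epsilon> t"
      "\<And>\<epsilon>. \<epsilon> \<ge> N \<Longrightarrow> improper_integral_infinite t0 (\<lambda>\<tau>. (1 / p \<epsilon> \<tau>) *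
        integral {t0..\<tau>} (\<lambda>s. exp (- integral {s..\<tau>} (q \<epsilon>)) * r \<epsilon> s))"
  shows False
proof (cases "\<forall>t>T. y t \<ge> 0")
  case True
  define s where "s = T + 1"
  have s: "s > T" "s \<ge> t0" using assms(1) by (auto simp: s_def)
  \<comment> \<open>\<open>\<phi>\<close> is nondecreasing beyond \<open>s\<close>, so
    \<open>\<phi> s\<close> bounds it from below there and (B) applies at every later time with this
    single \<open>\<epsilon>\<close>.\<close>
  define \<epsilon> where "\<epsilon> = min \<epsilon>0 (\<phi> s)"
  have \<epsilon>: "0 < \<epsilon>" "\<epsilon> \<le> \<epsilon>0" using pos[OF s(1)] \<open>\<epsilon>0 > 0\<close> by (auto simp: \<epsilon>_def)
  have ge: "\<bar>\<phi> t\<bar> \<ge> \<epsilon>" if t: "t \<ge> s" for t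
  proof -
    have "\<phi> s \<le> \<phi> t"
      by (rule phi_mono_if_y_nonneg) (use s t True in \<open>auto intro!: less_imp_le[OF pos]\<close>)
    then show ?thesis by (auto simp: \<epsilon>_def)
  qed
  have "\<not> linear_equation_oscillatory t0 (p \<epsilon>) (q \<epsilon>) (r \<epsilon>)"
    by (rule not_oscillatory_if_y_nonneg[OF s(2)])
       (use s True pos p q r p_pos \<epsilon> B[OF \<epsilon> _ ge] in auto)
  then show False using osc[OF \<epsilon>] by simp
next
  case False
  then obtain s where s: "s > T" "y s < 0" by (auto simp: not_le)
  have decr: "\<phi> t \<le> \<phi> \<sigma>" and neg: "y \<sigma> < 0" if "s \<le> \<sigma>" "\<sigma> \<le> t" for \<sigma> t
  proof -
    show "y \<sigma> < 0"
      by (rule y_neg_persists(2)[of s]) (use s that assms(1) in \<open>auto intro!: less_imp_le[OF pos]\<close>)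
    then show "\<phi> t \<le> \<phi> \<sigma>"
      by (intro phi_antimono_if_y_nonpos) (use s that assms(1) in \<open>auto intro!: less_imp_le[OF pos]\<close>)
  qed
  have abs: "\<bar>\<phi> t\<bar> = \<phi> t" if "t \<ge> s" for t using pos[of t] s that by auto
  show False
  proof (cases "\<exists>\<sigma>\<ge>s. \<phi> \<sigma> \<le> N")
    case True
    then obtain \<sigma> where \<sigma>: "\<sigma> \<ge> s" "\<phi> \<sigma> \<le> N" by blast
    \<comment> \<open>\<open>\<phi>\<close> decreases from \<open>s\<close> on, so once it is at
      most \<open>N\<close> it stays in the range of (C1).\<close>
    have "\<bar>\<phi> t\<bar> \<le> N" if "t \<ge> \<sigma>" for t using decr[of \<sigma> t] abs[of t] \<sigma> that by auto
    then show False
      using s \<sigma> assms(1) neg[OF \<sigma>(1) order_refl] C1(1)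
      by (intro not_decreasing_while_small[OF _ _ _ Q P_pos _ _ C1(2), of \<sigma>])
         (auto intro!: less_imp_le[OF pos])
  next
    case False
    then have "\<phi> s \<ge> N" "\<phi> s > 0" using \<open>N > 0\<close> by (auto simp: not_le intro: less_imp_le)
    have bd: "N \<le> \<bar>\<phi> t\<bar>" "\<bar>\<phi> t\<bar> \<le> \<phi> s" if "t \<ge> s" for t
      using False[simplified, rule_format, OF that] decr[of s t] abs[of t] that by auto
    show False
      \<comment> \<open>Here \<open>\<phi>\<close> stays above \<open>N\<close>, and (C2) is used
        with \<open>\<epsilon> = \<phi> s\<close>, an upper bound for the decreasing
        \<open>\<phi>\<close>.\<close>
      by (rule not_decreasing_while_large[of s N, OF _ \<open>N > 0\<close> _ s(2) p q r p_pos _ _ _ C2(2)])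
         (use \<open>\<phi> s \<ge> N\<close> \<open>\<phi> s > 0\<close> bd abs C2(1)[OF \<open>\<phi> s \<ge> N\<close> _ bd] s assms(1) in auto)
  qed
qed

end

section \<open>From the nonlinear equation to the system frozen along a solution\<close>

theorem theorem3p5:
  fixes t0 :: real
    and p0 q0 r0 :: "real \<Rightarrow> real \<Rightarrow> real"
    and P Q :: "real \<Rightarrow> real"
    and p q r :: "real \<Rightarrow> real \<Rightarrow> real"
    and \<phi> :: "real \<Rightarrow> real"
  assumes cont_p0: "continuous_on ({t0..} \<times> UNIV) (\<lambda>(t, w). p0 t w)"
    and cont_q0: "continuous_on ({t0..} \<times> UNIV) (\<lambda>(t, w). q0 t w)"
    and cont_r0: "continuous_on ({t0..} \<times> UNIV) (\<lambda>(t, w). r0 t w)"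
    and p0_pos: "\<forall>t\<ge>t0. \<forall>w. p0 t w > 0"
    and cont_P: "continuous_on {t0..} P"
    and cont_Q: "continuous_on {t0..} Q"
    and P_pos: "\<forall>t\<ge>t0. P t > 0"
    and cont_p: "\<forall>\<epsilon>>0. continuous_on {t0..} (p \<epsilon>)"
    and cont_q: "\<forall>\<epsilon>>0. continuous_on {t0..} (q \<epsilon>)"
    and cont_r: "\<forall>\<epsilon>>0. continuous_on {t0..} (r \<epsilon>)"
    and p_pos: "\<forall>\<epsilon>>0. \<forall>t\<ge>t0. p \<epsilon> t > 0"
    and A: "\<forall>t\<ge>t0. \<forall>w. r0 t w \<ge> 0"
    and B: "\<exists>\<epsilon>0>0. \<forall>\<epsilon>. 0 < \<epsilon> \<and> \<epsilon> \<le> \<epsilon>0 \<longrightarrow>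
              (\<forall>t\<ge>t0. \<forall>w. \<bar>w\<bar> \<ge> \<epsilon> \<longrightarrow>
                 p0 t w \<le> p \<epsilon> t \<and> q0 t w / p0 t w \<ge> q \<epsilon> t / p \<epsilon> t \<and> r0 t w \<ge> r \<epsilon> t) \<and>
              linear_equation_oscillatory t0 (p \<epsilon>) (q \<epsilon>) (r \<epsilon>)"
    and C: "\<exists>N>0.
              ((\<forall>t\<ge>t0. \<forall>w. \<bar>w\<bar> \<le> N \<longrightarrow> p0 t w \<le> P t \<and> q0 t w / p0 t w \<le> Q t) \<and>
               improper_integral_infinite t0 (\<lambda>\<tau>. exp (- integral {t0..\<tau>} Q) * (1 / P \<tau>))) \<and>
              (\<forall>\<epsilon>\<ge>N.
                 (\<forall>t\<ge>t0. \<forall>w. N \<le> \<bar>w\<bar> \<and> \<bar>w\<bar> \<le> \<epsilon> \<longrightarrow>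
                    p0 t w \<le> p \<epsilon> t \<and> q0 t w / p0 t w \<le> q \<epsilon> t \<and> r0 t w \<ge> r \<epsilon> t) \<and>
                 improper_integral_infinite t0
                   (\<lambda>\<tau>. (1 / p \<epsilon> \<tau>) *
                        integral {t0..\<tau>} (\<lambda>s. exp (- integral {s..\<tau>} (q \<epsilon>)) * r \<epsilon> s)))"
    and sol: "is_solution t0 p0 q0 r0 \<phi>"
    and nontriv: "nontrivial_on {t0..} \<phi>"
  shows "oscillatory_solution t0 p0 q0 r0 \<phi> \<or> singular_oscillatory_first_kind t0 p0 q0 r0 \<phi>"
proof (cases "\<forall>T\<ge>t0. changes_sign_on {T<..} \<phi>")
  case True
  then show ?thesis using sol by (simp add: oscillatory_solution_def)
next
  case False
  then obtain T where T: "t0 \<le> T" "\<not> changes_sign_on {T<..} \<phi>" by blast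
  have phi_cont: "continuous_on {t0..} \<phi>"
    using sol by (auto simp: is_solution_def C1_on_with_def intro: DERIV_continuous_on)
  have cont: "continuous_on {t0..} (\<lambda>t. f t (\<phi> t))"
    if f: "continuous_on ({t0..} \<times> UNIV) (\<lambda>(t, w). f t w)" for f :: "real \<Rightarrow> real \<Rightarrow> real"
  proof -
    have "continuous_on {t0..} (\<lambda>t. (t, \<phi> t))" by (intro continuous_intros phi_cont)
    from continuous_on_compose2[OF f this] show ?thesis by auto
  qed
  obtain y where "sturm_system t0 (\<lambda>t. p0 t (\<phi> t)) (\<lambda>t. q0 t (\<phi> t) / p0 t (\<phi> t)) (\<lambda>t. r0 t (\<phi> t)) \<phi> y"
    by (rule is_solution_imp_sturm_system[OF sol cont[OF cont_p0] cont[OF cont_q0]])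
       (use p0_pos in auto)
  then interpret sturm_system_nonneg t0 "\<lambda>t. p0 t (\<phi> t)" "\<lambda>t. q0 t (\<phi> t) / p0 t (\<phi> t)"
      "\<lambda>t. r0 t (\<phi> t)" \<phi> y
    by (intro sturm_system_nonneg.intro sturm_system_nonneg_axioms.intro) (use A in auto)
  show ?thesis
  \<comment> \<open>Vanishing near infinity leads to the singular case. Otherwise
    \<open>\<phi>\<close> is nonzero at arbitrarily large times, which upgrades a weak sign beyond
    \<open>T\<close> to a strict one.\<close>
  proof (cases "\<exists>T. \<forall>t>T. \<phi> t = 0")
    case True
    then obtain T' where T': "\<And>t. t > T' \<Longrightarrow> \<phi> t = 0" by blast
    have "{t \<in> {t0..}. \<phi> t \<noteq> 0} \<subseteq> {t0..T'}" using T' by (auto simp: not_less[symmetric])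
    then have "bounded (closure {t \<in> {t0..}. \<phi> t \<noteq> 0})"
      using bounded_subset[OF bounded_closed_interval] by (intro bounded_closure)
    then show ?thesis
      using sol changes_sign_infinitely_often_if_eventually_zero[OF nontriv T']
      by (simp add: singular_oscillatory_first_kind_def)
  next
    case False
    then have nz: "\<exists>t>T. \<phi> t \<noteq> 0" for T by blast
    obtain \<epsilon>0 where \<epsilon>0: "\<epsilon>0 > 0"
      "\<And>\<epsilon> t w. \<lbrakk>0 < \<epsilon>; \<epsilon> \<le> \<epsilon>0; t \<ge> t0; \<bar>w\<bar> \<ge> \<epsilon>\<rbrakk> \<Longrightarrow>
         p0 t w \<le> p \<epsilon> t \<and> q0 t w / p0 t w \<ge> q \<epsilon> t / p \<epsilon> t \<and> r0 t w \<ge> r \<epsilon> t"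
      "\<And>\<epsilon>. \<lbrakk>0 < \<epsilon>; \<epsilon> \<le> \<epsilon>0\<rbrakk> \<Longrightarrow> linear_equation_oscillatory t0 (p \<epsilon>) (q \<epsilon>) (r \<epsilon>)"
      using B by blast
    obtain N where N: "N > 0"
      "\<And>t w. \<lbrakk>t \<ge> t0; \<bar>w\<bar> \<le> N\<rbrakk> \<Longrightarrow> p0 t w \<le> P t \<and> q0 t w / p0 t w \<le> Q t"
      "improper_integral_infinite t0 (\<lambda>\<tau>. exp (- integral {t0..\<tau>} Q) * (1 / P \<tau>))"
      "\<And>\<epsilon> t w. \<lbrakk>\<epsilon> \<ge> N; t \<ge> t0; N \<le> \<bar>w\<bar>; \<bar>w\<bar> \<le> \<epsilon>\<rbrakk> \<Longrightarrow>
         p0 t w \<le> p \<epsilon> t \<and> q0 t w / p0 t w \<le> q \<epsilon> t \<and> r0 t w \<ge> r \<epsilon> t"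
      "\<And>\<epsilon>. \<epsilon> \<ge> N \<Longrightarrow> improper_integral_infinite t0 (\<lambda>\<tau>. (1 / p \<epsilon> \<tau>) *
         integral {t0..\<tau>} (\<lambda>s. exp (- integral {s..\<tau>} (q \<epsilon>)) * r \<epsilon> s))"
      using C by blast
    \<comment> \<open>\<open>f\<close> stands for \<open>\<phi>\<close> or \<open>- \<phi>\<close>;
      in both cases the coefficients remain frozen along \<open>\<phi>\<close> itself.\<close>
    have not_nonneg: False
      if f: "sturm_system_nonneg t0 (\<lambda>t. p0 t (\<phi> t)) (\<lambda>t. q0 t (\<phi> t) / p0 t (\<phi> t))
          (\<lambda>t. r0 t (\<phi> t)) f z"
        and abs_f: "\<And>t. \<bar>f t\<bar> = \<bar>\<phi> t\<bar>" and nn: "\<And>t. t > T \<Longrightarrow> f t \<ge> 0" for f z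
    proof (rule sturm_system_nonneg.not_eventually_positive[where P = P and Q = Q and p = p
          and q = q and r = r and N = N and ?\<epsilon>0.0 = \<epsilon>0, OF f T(1)])
      have "\<exists>t>T. f t \<noteq> 0" for T using nz[of T] abs_f by (metis abs_eq_0)
      then show "f t > 0" if "t > T" for t
        using sturm_system_nonneg.positive_if_nonneg[OF f T(1) nn] that by blast
    qed (use cont_Q P_pos cont_p cont_q cont_r p_pos \<epsilon>0 N abs_f in auto)
    have "(\<forall>t>T. \<phi> t \<ge> 0) \<or> (\<forall>t>T. \<phi> t \<le> 0)"
      using T(2) unfolding changes_sign_on_def by (meson greaterThan_iff not_le)
    then show ?thesis
      using not_nonneg[OF sturm_system_nonneg_axioms]
        not_nonneg[OF sturm_system_nonneg_minus] by auto
  qed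
qed

end
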